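(* Let $$G=\bigl\{w=(w_1,w_2,w_3,w_4)\in\mathbb{C}^4:\ |w_1|^2+|w_2|^2+|w_3|^2+|w_4|^2<1,\ w_1w_4=w_2w_3\bigr\},$$ a relatively compact domain in the algebraic variety $V=\{w\in\mathbb{C}^4: w_1w_4=w_2w_3\}$. Then the boundary $M=\partial G$ of $G$ in $V$ is homogeneous and non-spherical.
   Context: $M=\{w\in V:\|w\|=1\}$ is a smooth strongly pseudoconvex CR hypersurface (of real dimension $5$) in the regular part of $V$. It is homogeneous if its group of CR automorphisms acts transitively on it. A CR hypersurface $M$ of dimension $2n-1$ is spherical if near each point $p\in M$ it is locally CR diffeomorphic to an open piece of the unit sphere $S^{2n-1}\subset\mathbb{C}^n$; non-spherical means not spherical. *)

theory Defs
  imports "HOL-Analysis.Analysis"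
begin

text \<open>CR geometry of subsets of complex coordinate spaces. All notions below are meant for
  smooth embedded real submanifolds \<open>M\<close> with the CR structure induced by the ambient space.\<close>

primrec Ck_on :: "nat \<Rightarrow> 'a::real_normed_vector set \<Rightarrow> ('a \<Rightarrow> 'b::real_normed_vector) \<Rightarrow> bool" where
  "Ck_on 0 U f \<longleftrightarrow> continuous_on U f"
| "Ck_on (Suc k) U f \<longleftrightarrow>
     (\<forall>x\<in>U. f differentiable (at x)) \<and> (\<forall>v. Ck_on k U (\<lambda>x. frechet_derivative f (at x) v))"

text \<open>Only to be used for open \<open>U\<close>.\<close>

definition smooth_on :: "'a::real_normed_vector set \<Rightarrow> ('a \<Rightarrow> 'b::real_normed_vector) \<Rightarrow> bool" where
  "smooth_on U f \<longleftrightarrow> (\<forall>k. Ck_on k U f)"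

text \<open>Velocities of curves in \<open>M\<close> through \<open>p\<close>. Differentiability of the curve at time \<open>0\<close> is
  enough: for an embedded submanifold, locally the zero set of a submersion, the chain rule shows
  that such curves and smooth curves have the same velocities.\<close>

definition tangent_space :: "'a::real_normed_vector set \<Rightarrow> 'a \<Rightarrow> 'a set" where
  "tangent_space M p =
     {v. \<exists>\<gamma> :: real \<Rightarrow> 'a. \<gamma> 0 = p \<and> (\<forall>\<^sub>F t in nhds 0. \<gamma> t \<in> M) \<and>
           (\<gamma> has_vector_derivative v) (at 0)}"

definition complex_tangent_space :: "(complex^'n) set \<Rightarrow> complex^'n \<Rightarrow> (complex^'n) set" where
  "complex_tangent_space M p = tangent_space M p \<inter> (\<lambda>v. \<i> *s v) ` tangent_space M p"

text \<open>A smooth map whose differential maps complex tangent spaces complex-linearly into complex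
  tangent spaces. Smoothness on \<open>M\<close> means local smooth extendability; on vectors tangent to \<open>M\<close>
  the differential does not depend on the chosen local extension \<open>F\<close>.\<close>

definition CR_map ::
  "(complex^'n) set \<Rightarrow> (complex^'m) set \<Rightarrow> (complex^'n \<Rightarrow> complex^'m) \<Rightarrow> bool" where
  "CR_map M N f \<longleftrightarrow> f ` M \<subseteq> N \<and>
     (\<forall>p\<in>M. \<exists>U F. open U \<and> p \<in> U \<and> smooth_on U F \<and> (\<forall>x\<in>M \<inter> U. F x = f x) \<and>
        (\<forall>v\<in>complex_tangent_space M p.
           frechet_derivative F (at p) v \<in> complex_tangent_space N (f p) \<and>
           frechet_derivative F (at p) (\<i> *s v) = \<i> *s frechet_derivative F (at p) v))"

definition CR_diffeomorphism ::
  "(complex^'n) set \<Rightarrow> (complex^'m) set \<Rightarrow> (complex^'n \<Rightarrow> complex^'m) \<Rightarrow> bool" where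
  "CR_diffeomorphism M N f \<longleftrightarrow>
     bij_betw f M N \<and> CR_map M N f \<and> CR_map N M (inv_into M f)"

definition CR_homogeneous :: "(complex^'n) set \<Rightarrow> bool" where
  "CR_homogeneous M \<longleftrightarrow> (\<forall>p\<in>M. \<forall>q\<in>M. \<exists>f. CR_diffeomorphism M M f \<and> f p = q)"

text \<open>The type argument \<open>'d\<close> gives the model sphere in complex \<open>d\<close>-space, where \<open>d = CARD('d)\<close>;
  it has to be chosen such that the CR hypersurface \<open>M\<close> has real dimension \<open>2 d - 1\<close>
  (which need not be the maximal possible dimension in the ambient space of \<open>M\<close>).\<close>

definition CR_spherical :: "'d::finite itself \<Rightarrow> (complex^'n) set \<Rightarrow> bool" where
  "CR_spherical _ M \<longleftrightarrow>
     (\<forall>p\<in>M. \<exists>U W f. openin (top_of_set M) U \<and> p \<in> U \<and>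
        openin (top_of_set (sphere (0 :: complex^'d) 1)) W \<and> CR_diffeomorphism U W f)"

end

theory Submission
  imports Defs
begin

text \<open>
  \<open>M\<close> consists of the rank one matrices \<open>a b\<^sup>T\<close> with \<open>a, b \<in> S\<^sup>3\<close>; it is homogeneous under
  \<open>w \<mapsto> P w Q\<close> with \<open>P, Q \<in> SU(2)\<close>. For non-sphericality, pull a local CR map \<open>f\<close> into the unit
  sphere of complex 3-space back to \<open>F\<close> on \<open>S\<^sup>3 \<times> S\<^sup>3\<close>, whose left invariant fields give \<open>(1,0)\<close>
  derivations \<open>Z\<^sub>1, Z\<^sub>2\<close> with conjugates \<open>W\<^sub>1, W\<^sub>2\<close> satisfying the \<open>su(2)\<close> commutation relations,
  \<open>W\<^sub>j F = 0\<close>, and \<open>W\<^sub>1 Z\<^sub>1 F = W\<^sub>2 Z\<^sub>2 F\<close>. Differentiating \<open>\<langle>F, F\<rangle> = 1\<close> shows that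
  \<open>F, Z\<^sub>1 F, Z\<^sub>2 F\<close> are orthogonal with \<open>|Z\<^sub>1 F|\<^sup>2 = |Z\<^sub>2 F|\<^sup>2 = \<lambda>\<close>, and further differentiation gives
  \<open>|Z\<^sub>1 Z\<^sub>1 F|\<^sup>2 + |Z\<^sub>2 Z\<^sub>2 F|\<^sup>2 + 16 \<lambda> = 4 |Z\<^sub>1 Z\<^sub>2 F|\<^sup>2\<close>. Expanding the second derivatives in that
  orthogonal basis yields the same identity without the term \<open>16 \<lambda>\<close>, so \<open>\<lambda> = 0\<close>: the
  derivative of \<open>f\<close> is not injective. The term \<open>16 \<lambda>\<close> reflects that the Chern-Moser tensor of \<open>M\<close>
  does not vanish.
\<close>

section \<open>Smooth maps\<close>

text \<open>On an open set, agreement of values forces agreement of Frechet derivatives, so the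
  induction passes to the directional derivatives.\<close>

lemma Ck_on_cong:
  assumes "open U" "\<And>x. x \<in> U \<Longrightarrow> f x = g x" "Ck_on k U f"
  shows "Ck_on k U g"
  using assms(2,3)
proof (induction k arbitrary: f g)
  case 0
  then show ?case by (auto cong: continuous_on_cong)
next
  case (Suc k)
  have d: "f differentiable at x" if "x \<in> U" for x
    using Suc.prems(2) that by simp
  have gd: "(g has_derivative frechet_derivative f (at x)) (at x)" if "x \<in> U" for x
    by (rule has_derivative_transform_within_open[OF
        d[OF that, unfolded frechet_derivative_works] assms(1) that Suc.prems(1)])
  then have eq: "frechet_derivative f (at x) = frechet_derivative g (at x)" if "x \<in> U" for x
    using frechet_derivative_at that by blast
  have "Ck_on k U (\<lambda>x. frechet_derivative g (at x) v)" for v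
    using Suc.IH[of "\<lambda>x. frechet_derivative f (at x) v"] Suc.prems(2) eq by simp
  then show ?case
    using gd by (auto simp: differentiable_def)
qed

text \<open>Lets an explicitly computed derivative replace the opaque
  \<open>frechet_derivative\<close> in the recursion; the rules for linear maps, sums, products and
  compositions rest on it.\<close>

lemma Ck_on_SucI:
  assumes "open U" "\<And>x. x \<in> U \<Longrightarrow> (f has_derivative f' x) (at x)"
    and "\<And>v. Ck_on k U (\<lambda>x. f' x v)"
  shows "Ck_on (Suc k) U f"
proof -
  have "f' x = frechet_derivative f (at x)" if "x \<in> U" for x
    using assms(2) that frechet_derivative_at by blast
  then have "Ck_on k U (\<lambda>x. frechet_derivative f (at x) v)" for v
    by (intro Ck_on_cong[OF assms(1) _ assms(3)[of v]]) simp
  then show ?thesis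
    using assms(2) by (auto simp: differentiable_def)
qed

lemma Ck_on_has_derivative:
  assumes "Ck_on (Suc k) U f" "x \<in> U"
  shows "(f has_derivative frechet_derivative f (at x)) (at x)"
  using assms frechet_derivative_works by auto

lemma Ck_on_Suc_imp: "Ck_on (Suc k) U f \<Longrightarrow> Ck_on k U f"
proof (induction k arbitrary: f)
  case 0
  then show ?case
    by (auto intro!: differentiable_imp_continuous_on differentiable_at_imp_differentiable_on)
qed auto

lemma Ck_on_subset: "Ck_on k U f \<Longrightarrow> V \<subseteq> U \<Longrightarrow> Ck_on k V f"
  by (induction k arbitrary: f) (auto intro: continuous_on_subset)

lemma Ck_on_const: "Ck_on k U (\<lambda>x. c)"
  by (induction k arbitrary: c) auto

lemma Ck_on_bounded_linear:
  assumes "bounded_linear L" "open U"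
  shows "Ck_on k U f \<Longrightarrow> Ck_on k U (\<lambda>x. L (f x))"
proof (induction k arbitrary: f)
  case 0
  then show ?case
    using assms(1) by (auto intro: bounded_linear.continuous_on)
next
  case (Suc k)
  show ?case
  proof (rule Ck_on_SucI[OF assms(2)])
    show "((\<lambda>x. L (f x)) has_derivative (\<lambda>v. L (frechet_derivative f (at x) v))) (at x)"
      if "x \<in> U" for x
      using bounded_linear.has_derivative[OF assms(1) Ck_on_has_derivative[OF Suc.prems that]] .
    show "Ck_on k U (\<lambda>x. L (frechet_derivative f (at x) v))" for v
      using Suc by auto
  qed
qed

lemma Ck_on_id: "open U \<Longrightarrow> Ck_on k U (\<lambda>x. x)"
  by (cases k) (auto intro!: Ck_on_SucI Ck_on_const intro: has_derivative_ident)

lemma Ck_on_add: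
  assumes "open U"
  shows "Ck_on k U f \<Longrightarrow> Ck_on k U g \<Longrightarrow> Ck_on k U (\<lambda>x. f x + g x)"
proof (induction k arbitrary: f g)
  case 0
  then show ?case by (auto intro: continuous_intros)
next
  case (Suc k)
  show ?case
  proof (rule Ck_on_SucI[OF assms])
    show "((\<lambda>x. f x + g x) has_derivative
        (\<lambda>v. frechet_derivative f (at x) v + frechet_derivative g (at x) v)) (at x)" if "x \<in> U" for x
      using Suc.prems that by (intro has_derivative_add Ck_on_has_derivative)
    show "Ck_on k U (\<lambda>x. frechet_derivative f (at x) v + frechet_derivative g (at x) v)" for v
      using Suc by auto
  qed
qed

lemma Ck_on_sum:
  assumes "open U" "\<And>i. i \<in> I \<Longrightarrow> Ck_on k U (f i)"
  shows "Ck_on k U (\<lambda>x. \<Sum>i\<in>I. f i x)"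
  using assms(2) by (induction I rule: infinite_finite_induct)
    (auto intro: Ck_on_const Ck_on_add[OF assms(1)])

lemma Ck_on_bilinear:
  assumes "bounded_bilinear B" "open U"
  shows "Ck_on k U f \<Longrightarrow> Ck_on k U g \<Longrightarrow> Ck_on k U (\<lambda>x. B (f x) (g x))"
proof (induction k arbitrary: f g)
  case 0
  then show ?case
    using bounded_bilinear.continuous_on[OF assms(1)] by auto
next
  case (Suc k)
  show ?case
  proof (rule Ck_on_SucI[OF assms(2)])
    show "((\<lambda>x. B (f x) (g x)) has_derivative
        (\<lambda>v. B (f x) (frechet_derivative g (at x) v) + B (frechet_derivative f (at x) v) (g x))) (at x)"
      if "x \<in> U" for x
      using Suc.prems that
      by (intro bounded_bilinear.FDERIV[OF assms(1)] Ck_on_has_derivative)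
    show "Ck_on k U (\<lambda>x. B (f x) (frechet_derivative g (at x) v) + B (frechet_derivative f (at x) v) (g x))"
      for v
      using Suc.IH Suc.prems Ck_on_Suc_imp[OF Suc.prems(1)] Ck_on_Suc_imp[OF Suc.prems(2)]
      by (intro Ck_on_add[OF assms(2)]) auto
  qed
qed

lemma linear_euclidean_expansion:
  fixes v :: "'a::euclidean_space"
  assumes "linear L"
  shows "L v = (\<Sum>i\<in>Basis. (v \<bullet> i) *\<^sub>R L i)"
proof -
  have "L v = L (\<Sum>i\<in>Basis. (v \<bullet> i) *\<^sub>R i)"
    by (simp only: euclidean_representation)
  then show ?thesis
    by (simp only: linear_sum[OF assms] linear_cmul[OF assms])
qed

text \<open>The chain rule evaluates the derivative of \<open>f\<close> in a direction that moves
  with \<open>x\<close>, while \<open>Ck_on\<close> controls fixed directions only. Expanding this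
  direction over \<open>Basis\<close> leaves a finite sum of products within reach of the
  induction.\<close>

lemma Ck_on_compose:
  fixes f :: "'b::euclidean_space \<Rightarrow> 'c::real_normed_vector" and g :: "'a::real_normed_vector \<Rightarrow> 'b"
  assumes "open U" "open V" "g ` U \<subseteq> V"
  shows "Ck_on k V f \<Longrightarrow> Ck_on k U g \<Longrightarrow> Ck_on k U (\<lambda>x. f (g x))"
proof (induction k arbitrary: f)
  case 0
  then show ?case
    using assms(3) continuous_on_compose2 by auto
next
  case (Suc k)
  show ?case
  proof (rule Ck_on_SucI[OF assms(1)])
    fix x assume x: "x \<in> U"
    have df: "(f has_derivative frechet_derivative f (at (g x))) (at (g x))"
      using Suc.prems(1) x assms(3) by (intro Ck_on_has_derivative) auto
    have "((\<lambda>x. f (g x)) has_derivative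
        (\<lambda>v. frechet_derivative f (at (g x)) (frechet_derivative g (at x) v))) (at x)"
      using has_derivative_compose[OF Ck_on_has_derivative[OF Suc.prems(2) x] df] .
    moreover have "(\<lambda>v. frechet_derivative f (at (g x)) (frechet_derivative g (at x) v)) =
        (\<lambda>v. \<Sum>i\<in>Basis. (frechet_derivative g (at x) v \<bullet> i)
          *\<^sub>R frechet_derivative f (at (g x)) i)"
      by (rule ext) (rule linear_euclidean_expansion[OF has_derivative_linear[OF df]])
    ultimately show "((\<lambda>x. f (g x)) has_derivative (\<lambda>v. \<Sum>i\<in>Basis. (frechet_derivative g (at x) v \<bullet> i)
        *\<^sub>R frechet_derivative f (at (g x)) i)) (at x)"
      by (simp only:)
  next
    fix v
    show "Ck_on k U (\<lambda>x. \<Sum>i\<in>Basis. (frechet_derivative g (at x) v \<bullet> i)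
        *\<^sub>R frechet_derivative f (at (g x)) i)"
    proof (intro Ck_on_sum[OF assms(1)] Ck_on_bilinear[OF bounded_bilinear_scaleR assms(1)])
      fix i :: 'b
      show "Ck_on k U (\<lambda>x. frechet_derivative g (at x) v \<bullet> i)"
        using Suc.prems(2)
        by (intro Ck_on_bounded_linear[OF bounded_linear_inner_left assms(1)]) auto
      show "Ck_on k U (\<lambda>x. frechet_derivative f (at (g x)) i)"
        using Suc.IH[of "\<lambda>y. frechet_derivative f (at y) i"] Suc.prems
          Ck_on_Suc_imp[OF Suc.prems(2)] by auto
    qed
  qed
qed

lemma smooth_on_has_derivative:
  assumes "smooth_on U f" "x \<in> U"
  shows "(f has_derivative frechet_derivative f (at x)) (at x)"
  by (rule Ck_on_has_derivative[OF _ assms(2)], rule assms(1)[unfolded smooth_on_def, rule_format])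

lemma smooth_on_differentiable: "smooth_on U f \<Longrightarrow> x \<in> U \<Longrightarrow> f differentiable at x"
  unfolding differentiable_def by (rule exI, rule smooth_on_has_derivative)

lemma smooth_on_subset: "smooth_on U f \<Longrightarrow> V \<subseteq> U \<Longrightarrow> smooth_on V f"
  by (auto simp add: smooth_on_def intro: Ck_on_subset)

lemma smooth_on_cong:
  "open U \<Longrightarrow> (\<And>x. x \<in> U \<Longrightarrow> f x = g x) \<Longrightarrow> smooth_on U f \<Longrightarrow> smooth_on U g"
  unfolding smooth_on_def by (intro allI, rule Ck_on_cong[of U f]) auto

lemma smooth_on_add: "open U \<Longrightarrow> smooth_on U f \<Longrightarrow> smooth_on U g \<Longrightarrow> smooth_on U (\<lambda>x. f x + g x)"
  by (simp add: smooth_on_def Ck_on_add)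

lemma smooth_on_sum:
  "open U \<Longrightarrow> (\<And>i. i \<in> I \<Longrightarrow> smooth_on U (f i)) \<Longrightarrow> smooth_on U (\<lambda>x. \<Sum>i\<in>I. f i x)"
  by (simp add: smooth_on_def Ck_on_sum)

lemma smooth_on_bounded_linear:
  "bounded_linear L \<Longrightarrow> open U \<Longrightarrow> smooth_on U f \<Longrightarrow> smooth_on U (\<lambda>x. L (f x))"
  by (simp add: smooth_on_def Ck_on_bounded_linear)

lemma smooth_on_bilinear:
  "bounded_bilinear B \<Longrightarrow> open U \<Longrightarrow> smooth_on U f \<Longrightarrow> smooth_on U g \<Longrightarrow>
    smooth_on U (\<lambda>x. B (f x) (g x))"
  by (simp add: smooth_on_def Ck_on_bilinear)

lemma smooth_on_linear:
  assumes "bounded_linear L" "open U"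
  shows "smooth_on U L"
  unfolding smooth_on_def
  by (rule allI) (rule Ck_on_bounded_linear[OF assms Ck_on_id[OF assms(2)]])

lemma smooth_on_compose:
  fixes f :: "'b::euclidean_space \<Rightarrow> 'c::real_normed_vector" and g :: "'a::real_normed_vector \<Rightarrow> 'b"
  assumes "open U" "open V" "g ` U \<subseteq> V" "smooth_on V f" "smooth_on U g"
  shows "smooth_on U (\<lambda>x. f (g x))"
  unfolding smooth_on_def
proof
  fix k
  have "Ck_on k V f" "Ck_on k U g"
    using assms(4,5) unfolding smooth_on_def by simp_all
  then show "Ck_on k U (\<lambda>x. f (g x))"
    by (rule Ck_on_compose[OF assms(1-3)])
qed

lemma smooth_on_frechet_derivative:
  assumes "smooth_on U f"
  shows "smooth_on U (\<lambda>x. frechet_derivative f (at x) v)"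
  unfolding smooth_on_def
proof
  fix k
  have "Ck_on (Suc k) U f"
    using assms unfolding smooth_on_def by (rule spec)
  then show "Ck_on k U (\<lambda>x. frechet_derivative f (at x) v)"
    by simp
qed

text \<open>Schwarz: both mixed derivatives are values, at points near \<open>x\<close>, of the same second
  difference quotient.\<close>

lemma second_difference_mvt:
  fixes f :: "'a::real_normed_vector \<Rightarrow> real"
  assumes f: "smooth_on (ball x r) f" and h: "0 < h" "h * (norm v + norm w) < r"
  obtains y where "y \<in> cball x (h * (norm v + norm w))"
    "f (x + h *\<^sub>R v + h *\<^sub>R w) - f (x + h *\<^sub>R v) - f (x + h *\<^sub>R w) + f x =
      h * h * frechet_derivative (\<lambda>z. frechet_derivative f (at z) v) (at y) w"
proof -
  have dist: "x + s *\<^sub>R v + t *\<^sub>R w \<in> cball x (h * (norm v + norm w))"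
    if "0 \<le> s" "s \<le> h" "0 \<le> t" "t \<le> h" for s t
  proof -
    have "norm (s *\<^sub>R v + t *\<^sub>R w) \<le> s * norm v + t * norm w"
      using norm_triangle_ineq[of "s *\<^sub>R v" "t *\<^sub>R w"] that by simp
    also have "\<dots> \<le> h * norm v + h * norm w"
      using that by (intro add_mono mult_right_mono) auto
    finally have "norm (s *\<^sub>R v + t *\<^sub>R w) \<le> h * (norm v + norm w)"
      by (simp only: distrib_left)
    moreover have "dist x (x + (s *\<^sub>R v + t *\<^sub>R w)) = norm (s *\<^sub>R v + t *\<^sub>R w)"
      by (metis add_diff_cancel_left' dist_commute dist_norm)
    ultimately show ?thesis
      by (simp only: mem_cball add.assoc)
  qed
  have inb: "x + s *\<^sub>R v + t *\<^sub>R w \<in> ball x r" if "0 \<le> s" "s \<le> h" "0 \<le> t" "t \<le> h" for s t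
    using dist[OF that] h(2) by auto
  \<comment> \<open>\<open>p h - p 0\<close> is the second difference. The mean value theorem, in
    \<open>s\<close> here and in \<open>t\<close> below, produces the point
    \<open>y\<close>.\<close>
  define p where "p s = f (x + s *\<^sub>R v + h *\<^sub>R w) - f (x + s *\<^sub>R v)" for s
  define p' where "p' s = (\<lambda>k. frechet_derivative f (at (x + s *\<^sub>R v + h *\<^sub>R w)) (k *\<^sub>R v)
      - frechet_derivative f (at (x + s *\<^sub>R v)) (k *\<^sub>R v))" for s
  have "(p has_derivative p' s) (at s within {0..h})" if "0 \<le> s" "s \<le> h" for s
    unfolding p_def p'_def
  proof (intro has_derivative_diff)
    have "((\<lambda>s. x + s *\<^sub>R v + h *\<^sub>R w) has_derivative (\<lambda>k. k *\<^sub>R v)) (at s within {0..h})"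
      by (auto intro!: derivative_eq_intros)
    then show "((\<lambda>s. f (x + s *\<^sub>R v + h *\<^sub>R w)) has_derivative
        (\<lambda>k. frechet_derivative f (at (x + s *\<^sub>R v + h *\<^sub>R w)) (k *\<^sub>R v))) (at s within {0..h})"
      by (rule has_derivative_compose)
        (use smooth_on_has_derivative[OF f] inb[OF that, of h] h(1) in auto)
    have "((\<lambda>s. x + s *\<^sub>R v) has_derivative (\<lambda>k. k *\<^sub>R v)) (at s within {0..h})"
      by (auto intro!: derivative_eq_intros)
    then show "((\<lambda>s. f (x + s *\<^sub>R v)) has_derivative
        (\<lambda>k. frechet_derivative f (at (x + s *\<^sub>R v)) (k *\<^sub>R v))) (at s within {0..h})"
      by (rule has_derivative_compose)
        (use smooth_on_has_derivative[OF f] inb[OF that, of 0] h(1) in auto)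
  qed
  then obtain s where s: "0 < s" "s < h" "p h - p 0 = p' s h"
    using mvt_simple[of 0 h p p'] h(1) by auto
  define q where "q t = frechet_derivative f (at (x + s *\<^sub>R v + t *\<^sub>R w)) v" for t
  define q' where "q' t = (\<lambda>k. frechet_derivative (\<lambda>z. frechet_derivative f (at z) v)
      (at (x + s *\<^sub>R v + t *\<^sub>R w)) (k *\<^sub>R w))" for t
  have "(q has_derivative q' t) (at t within {0..h})" if "0 \<le> t" "t \<le> h" for t
    unfolding q_def q'_def
  proof -
    have "((\<lambda>t. x + s *\<^sub>R v + t *\<^sub>R w) has_derivative (\<lambda>k. k *\<^sub>R w)) (at t within {0..h})"
      by (auto intro!: derivative_eq_intros)
    then show "((\<lambda>t. frechet_derivative f (at (x + s *\<^sub>R v + t *\<^sub>R w)) v) has_derivative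
        (\<lambda>k. frechet_derivative (\<lambda>z. frechet_derivative f (at z) v)
          (at (x + s *\<^sub>R v + t *\<^sub>R w)) (k *\<^sub>R w))) (at t within {0..h})"
      by (rule has_derivative_compose)
        (use smooth_on_has_derivative[OF smooth_on_frechet_derivative[OF f]]
          inb[OF _ _ that, of s] s in auto)
  qed
  then obtain t where t: "0 < t" "t < h" "q h - q 0 = q' t h"
    using mvt_simple[of 0 h q q'] h(1) by auto
  let ?y = "x + s *\<^sub>R v + t *\<^sub>R w"
  have lin: "frechet_derivative f (at z) (h *\<^sub>R v) = h * frechet_derivative f (at z) v"
    if "z \<in> ball x r" for z
    using linear_cmul[OF has_derivative_linear[OF smooth_on_has_derivative[OF f that]]] by simp
  have lin2: "q' t h = h * frechet_derivative (\<lambda>z. frechet_derivative f (at z) v) (at ?y) w"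
    using linear_cmul[OF has_derivative_linear[OF smooth_on_has_derivative[OF
      smooth_on_frechet_derivative[OF f] inb[of s t]]]] s t unfolding q'_def by simp
  have "p h - p 0 = h * (q h - q 0)"
    using s inb[of s h] inb[of s 0] h(1) lin unfolding p'_def q_def
    by (simp add: right_diff_distrib)
  moreover have "p h - p 0 = f (x + h *\<^sub>R v + h *\<^sub>R w) - f (x + h *\<^sub>R v) - f (x + h *\<^sub>R w) + f x"
    unfolding p_def by simp
  ultimately have "f (x + h *\<^sub>R v + h *\<^sub>R w) - f (x + h *\<^sub>R v) - f (x + h *\<^sub>R w) + f x =
      h * h * frechet_derivative (\<lambda>z. frechet_derivative f (at z) v) (at ?y) w"
    using t(3) lin2 by (simp only: mult.assoc)
  moreover have "?y \<in> cball x (h * (norm v + norm w))"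
    using s t by (intro dist) auto
  ultimately show thesis
    using that by blast
qed

lemma mixed_derivatives_commute_real:
  fixes f :: "'a::real_normed_vector \<Rightarrow> real"
  assumes U: "open U" "x \<in> U" and f: "smooth_on U f"
  shows "frechet_derivative (\<lambda>z. frechet_derivative f (at z) v) (at x) w =
    frechet_derivative (\<lambda>z. frechet_derivative f (at z) w) (at x) v"
proof -
  let ?A = "\<lambda>v w x. frechet_derivative (\<lambda>z. frechet_derivative f (at z) v) (at x) w"
  obtain r where r: "r > 0" "ball x r \<subseteq> U"
    using U openE by blast
  have cont: "continuous_on U (?A v w)" for v w
    using f unfolding smooth_on_def by (metis Ck_on.simps)
  have near: "\<exists>d>0. \<forall>y. dist y x < d \<longrightarrow> dist (?A v w y) (?A v w x) < e" if "e > 0" for e v w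
    using cont U that by (auto simp: continuous_on_eq_continuous_at continuous_at_eps_delta)
  have "\<bar>?A v w x - ?A w v x\<bar> < e" if "e > 0" for e
  proof -
    obtain d1 d2 where d: "d1 > 0" "d2 > 0"
      "\<And>y. dist y x < d1 \<Longrightarrow> dist (?A v w y) (?A v w x) < e / 2"
      "\<And>y. dist y x < d2 \<Longrightarrow> dist (?A w v y) (?A w v x) < e / 2"
      using near[of "e / 2"] \<open>e > 0\<close> by (metis half_gt_zero)
    define m where "m = min r (min d1 d2)"
    \<comment> \<open>The \<open>+ 1\<close> keeps the denominator positive when
      \<open>v = w = 0\<close>. With this \<open>h\<close>, both mean value points stay within
      distance \<open>m\<close> of \<open>x\<close>.\<close>
    define h where "h = m / (2 * (norm v + norm w + 1))"
    have m: "m > 0" using d r unfolding m_def by auto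
    have n: "norm v + norm w + 1 > 0" by (smt (verit) norm_ge_zero)
    have h: "h > 0" unfolding h_def using m n by auto
    have "h * (norm v + norm w) < h * (2 * (norm v + norm w + 1))"
      using h n by (intro mult_strict_left_mono) auto
    also have "\<dots> = m" unfolding h_def using n by (simp add: field_simps)
    finally have hm: "h * (norm v + norm w) < m" .
    then have hr: "h * (norm v + norm w) < r" "h * (norm w + norm v) < r"
      unfolding m_def by (simp_all add: add.commute)
    have f': "smooth_on (ball x r) f" using smooth_on_subset[OF f r(2)] .
    obtain y where y: "y \<in> cball x (h * (norm v + norm w))"
      "f (x + h *\<^sub>R v + h *\<^sub>R w) - f (x + h *\<^sub>R v) - f (x + h *\<^sub>R w) + f x = h * h * ?A v w y"
      using second_difference_mvt[OF f' h hr(1)] by blast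
    obtain z where z: "z \<in> cball x (h * (norm w + norm v))"
      "f (x + h *\<^sub>R w + h *\<^sub>R v) - f (x + h *\<^sub>R w) - f (x + h *\<^sub>R v) + f x = h * h * ?A w v z"
      using second_difference_mvt[OF f' h hr(2)] by blast
    have "f (x + h *\<^sub>R w + h *\<^sub>R v) = f (x + h *\<^sub>R v + h *\<^sub>R w)"
      by (simp add: algebra_simps)
    then have "h * h * ?A v w y = h * h * ?A w v z" using y(2) z(2) by linarith
    then have "?A v w y = ?A w v z" using h by simp
    moreover have "dist y x < d1" "dist z x < d2"
      using y(1) z(1) hm unfolding m_def by (auto simp: dist_commute add.commute)
    ultimately show ?thesis
      using d(3)[of y] d(4)[of z] unfolding dist_real_def by linarith
  qed
  \<comment> \<open>With the difference itself as \<open>e\<close>, a nonzero difference would be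
    smaller than itself.\<close>
  from this[of "\<bar>?A v w x - ?A w v x\<bar>"] show ?thesis
    by linarith
qed

lemma frechet_derivative_bounded_linear:
  assumes "bounded_linear L" "f differentiable at x"
  shows "frechet_derivative (\<lambda>x. L (f x)) (at x) = (\<lambda>v. L (frechet_derivative f (at x) v))"
  using frechet_derivative_at[OF bounded_linear.has_derivative[OF assms(1)
      assms(2)[unfolded frechet_derivative_works]]] by simp

lemma mixed_derivatives_commute:
  fixes f :: "'a::real_normed_vector \<Rightarrow> 'b::euclidean_space"
  assumes U: "open U" "x \<in> U" and f: "smooth_on U f"
  shows "frechet_derivative (\<lambda>z. frechet_derivative f (at z) v) (at x) w =
    frechet_derivative (\<lambda>z. frechet_derivative f (at z) w) (at x) v"
proof (rule euclidean_eqI)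
  fix b :: 'b
  have bl: "bounded_linear (\<lambda>y::'b. y \<bullet> b)" by (rule bounded_linear_inner_left)
  have s: "smooth_on U (\<lambda>x. f x \<bullet> b)" by (rule smooth_on_bounded_linear[OF bl U(1) f])
  have 1: "frechet_derivative (\<lambda>z. frechet_derivative f (at z) v) (at x) w \<bullet> b =
      frechet_derivative (\<lambda>z. frechet_derivative (\<lambda>x. f x \<bullet> b) (at z) v) (at x) w" for v w
  proof -
    have "frechet_derivative (\<lambda>z. frechet_derivative f (at z) v) (at x) w \<bullet> b =
        frechet_derivative (\<lambda>z. frechet_derivative f (at z) v \<bullet> b) (at x) w"
      using frechet_derivative_bounded_linear[OF bl smooth_on_differentiable[OF
        smooth_on_frechet_derivative[OF f] U(2)]] by simp
    also have "\<dots> = frechet_derivative (\<lambda>z. frechet_derivative (\<lambda>x. f x \<bullet> b) (at z) v) (at x) w"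
      using frechet_derivative_transform_within_open[OF smooth_on_differentiable[OF
          smooth_on_bounded_linear[OF bl U(1) smooth_on_frechet_derivative[OF f]] U(2)] U]
        frechet_derivative_bounded_linear[OF bl smooth_on_differentiable[OF f]]
      by (metis (mono_tags, lifting))
    finally show ?thesis .
  qed
  show "frechet_derivative (\<lambda>z. frechet_derivative f (at z) v) (at x) w \<bullet> b =
    frechet_derivative (\<lambda>z. frechet_derivative f (at z) w) (at x) v \<bullet> b"
    unfolding 1 by (rule mixed_derivatives_commute_real[OF U s])
qed

section \<open>The obstruction to sphericality\<close>

definition hdot :: "complex^'n \<Rightarrow> complex^'n \<Rightarrow> complex" where
  "hdot u v = (\<Sum>k\<in>UNIV. u$k * cnj (v$k))"

lemma hdot_add_left: "hdot (u + u') v = hdot u v + hdot u' v"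
  by (simp add: hdot_def algebra_simps sum.distrib)

lemma hdot_add_right: "hdot u (v + v') = hdot u v + hdot u v'"
  by (simp add: hdot_def algebra_simps sum.distrib)

lemma hdot_scale_left: "hdot (c *s u) v = c * hdot u v"
  by (simp add: hdot_def algebra_simps sum_distrib_left)

lemma hdot_scale_right: "hdot u (c *s v) = cnj c * hdot u v"
  by (simp add: hdot_def algebra_simps sum_distrib_left)

lemma hdot_0_left [simp]: "hdot 0 v = 0"
  by (simp add: hdot_def)

lemma hdot_0_right [simp]: "hdot u 0 = 0"
  by (simp add: hdot_def)

lemma cnj_hdot: "cnj (hdot u v) = hdot v u"
  by (simp add: hdot_def mult.commute)

lemma hdot_self: "hdot u u = of_real ((norm u)\<^sup>2)"
  by (simp add: hdot_def norm_vec_def L2_set_def sum_nonneg complex_mult_cnj cmod_power2)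

lemma hdot_self_eq_0_iff: "hdot u u = 0 \<longleftrightarrow> u = 0"
  by (simp add: hdot_self)

text \<open>Bilinearity holds over the reals only, as the second slot is conjugate-linear; that
  suffices for the product rule.\<close>

lemma bounded_bilinear_hdot: "bounded_bilinear hdot"
proof -
  have "bilinear hdot"
    unfolding bilinear_def
    by (auto intro!: linearI simp: hdot_def scaleR_sum_right algebra_simps sum.distrib)
  then show ?thesis
    by (simp add: bilinear_conv_bounded_bilinear)
qed

text \<open>Orthogonality makes \<open>B\<close> a right inverse of \<open>A\<close>. Both matrices
  are square, so it is also a left inverse, and \<open>B ** A = mat 1\<close> is the expansion of
  \<open>v\<close> in the vectors \<open>e j\<close>.\<close>

lemma hdot_parseval:
  fixes e :: "'n \<Rightarrow> complex^'n"
  assumes orth: "\<And>i j. i \<noteq> j \<Longrightarrow> hdot (e i) (e j) = 0" and nz: "\<And>i. e i \<noteq> 0"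
  shows "hdot v v = (\<Sum>j\<in>UNIV. hdot v (e j) * hdot (e j) v / hdot (e j) (e j))"
proof -
  define A :: "complex^'n^'n" where "A = (\<chi> i k. cnj (e i $ k))"
  define B :: "complex^'n^'n" where "B = (\<chi> k j. e j $ k / hdot (e j) (e j))"
  have "(A ** B) $ i $ j = mat 1 $ i $ j" for i j
  proof -
    have "(A ** B) $ i $ j = hdot (e j) (e i) / hdot (e j) (e j)"
      by (simp add: A_def B_def matrix_matrix_mult_def hdot_def sum_divide_distrib mult.commute)
    then show ?thesis
      using orth[of j i] nz[of j] by (auto simp: mat_def hdot_self_eq_0_iff)
  qed
  then have "A ** B = mat 1"
    by (simp add: vec_eq_iff)
  then have "B ** A = mat 1"
    using matrix_left_right_inverse by blast
  then have "B *v (A *v v) = v"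
    by (simp add: matrix_vector_mul_assoc)
  moreover have "(A *v v) $ j = hdot v (e j)" for j
    by (simp add: A_def matrix_vector_mult_def hdot_def mult.commute)
  ultimately have v: "v $ k = (\<Sum>j\<in>UNIV. e j $ k / hdot (e j) (e j) * hdot v (e j))" for k
    by (metis (no_types, lifting) B_def matrix_vector_mult_def sum.cong vec_lambda_beta)
  have "hdot v v = (\<Sum>k\<in>UNIV. \<Sum>j\<in>UNIV. e j $ k / hdot (e j) (e j) * hdot v (e j) * cnj (v $ k))"
    unfolding hdot_def[of v v] sum_distrib_right[symmetric] v[symmetric] by (rule refl)
  also have "\<dots> = (\<Sum>j\<in>UNIV. \<Sum>k\<in>UNIV. e j $ k / hdot (e j) (e j) * hdot v (e j) * cnj (v $ k))"
    by (rule sum.swap)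
  also have "\<dots> = (\<Sum>j\<in>UNIV. hdot v (e j) * hdot (e j) v / hdot (e j) (e j))"
  proof (rule sum.cong[OF refl])
    fix j
    show "(\<Sum>k\<in>UNIV. e j $ k / hdot (e j) (e j) * hdot v (e j) * cnj (v $ k)) =
        hdot v (e j) * hdot (e j) v / hdot (e j) (e j)"
      by (subst hdot_def[of "e j" v]) (simp add: sum_distrib_left sum_divide_distrib ac_simps)
  qed
  finally show ?thesis .
qed

text \<open>The \<open>8\<close> is the commutator constant in \<open>[[W1, Z1], Z1] = 8 Z1\<close>; it is what makes the assumptions
  contradictory for \<open>Z1 F \<noteq> 0\<close>.\<close>

locale spherical_frame =
  fixes N :: "'e set" and S :: "('e \<Rightarrow> complex^3) set"
    and Z1 W1 Z2 W2 :: "('e \<Rightarrow> complex^3) \<Rightarrow> 'e \<Rightarrow> complex^3"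
    and F K :: "'e \<Rightarrow> complex^3"
  assumes FS: "F \<in> S" and KS: "K \<in> S" and zeroS: "(\<lambda>x. 0) \<in> S"
    and Z1S: "u \<in> S \<Longrightarrow> Z1 u \<in> S" and Z2S: "u \<in> S \<Longrightarrow> Z2 u \<in> S"
    and Z1_0: "Z1 (\<lambda>x. 0) = (\<lambda>x. 0)" and W1_0: "W1 (\<lambda>x. 0) = (\<lambda>x. 0)"
    and Z2_0: "Z2 (\<lambda>x. 0) = (\<lambda>x. 0)" and W2_0: "W2 (\<lambda>x. 0) = (\<lambda>x. 0)"
    and Z1_diff: "\<lbrakk>u \<in> S; v \<in> S; u' \<in> S; v' \<in> S; u'' \<in> S; v'' \<in> S;
        \<And>x. x \<in> N \<Longrightarrow> hdot (u x) (v x) + hdot (u' x) (v' x) = hdot (u'' x) (v'' x) + c; x \<in> N\<rbrakk>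
      \<Longrightarrow> hdot (Z1 u x) (v x) + hdot (u x) (W1 v x) + (hdot (Z1 u' x) (v' x) + hdot (u' x) (W1 v' x))
        = hdot (Z1 u'' x) (v'' x) + hdot (u'' x) (W1 v'' x)"
    and W1_diff: "\<lbrakk>u \<in> S; v \<in> S; u' \<in> S; v' \<in> S; u'' \<in> S; v'' \<in> S;
        \<And>x. x \<in> N \<Longrightarrow> hdot (u x) (v x) + hdot (u' x) (v' x) = hdot (u'' x) (v'' x) + c; x \<in> N\<rbrakk>
      \<Longrightarrow> hdot (W1 u x) (v x) + hdot (u x) (Z1 v x) + (hdot (W1 u' x) (v' x) + hdot (u' x) (Z1 v' x))
        = hdot (W1 u'' x) (v'' x) + hdot (u'' x) (Z1 v'' x)"
    and Z2_diff: "\<lbrakk>u \<in> S; v \<in> S; u' \<in> S; v' \<in> S; u'' \<in> S; v'' \<in> S;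
        \<And>x. x \<in> N \<Longrightarrow> hdot (u x) (v x) + hdot (u' x) (v' x) = hdot (u'' x) (v'' x) + c; x \<in> N\<rbrakk>
      \<Longrightarrow> hdot (Z2 u x) (v x) + hdot (u x) (W2 v x) + (hdot (Z2 u' x) (v' x) + hdot (u' x) (W2 v' x))
        = hdot (Z2 u'' x) (v'' x) + hdot (u'' x) (W2 v'' x)"
    and W2_diff: "\<lbrakk>u \<in> S; v \<in> S; u' \<in> S; v' \<in> S; u'' \<in> S; v'' \<in> S;
        \<And>x. x \<in> N \<Longrightarrow> hdot (u x) (v x) + hdot (u' x) (v' x) = hdot (u'' x) (v'' x) + c; x \<in> N\<rbrakk>
      \<Longrightarrow> hdot (W2 u x) (v x) + hdot (u x) (Z2 v x) + (hdot (W2 u' x) (v' x) + hdot (u' x) (Z2 v' x))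
        = hdot (W2 u'' x) (v'' x) + hdot (u'' x) (Z2 v'' x)"
    and unit: "x \<in> N \<Longrightarrow> hdot (F x) (F x) = 1"
    and W1F: "x \<in> N \<Longrightarrow> W1 F x = 0" and W2F: "x \<in> N \<Longrightarrow> W2 F x = 0"
    and W1Z1F: "x \<in> N \<Longrightarrow> W1 (Z1 F) x = K x" and W2Z2F: "x \<in> N \<Longrightarrow> W2 (Z2 F) x = K x"
    and W1Z2F: "x \<in> N \<Longrightarrow> W1 (Z2 F) x = 0" and W2Z1F: "x \<in> N \<Longrightarrow> W2 (Z1 F) x = 0"
    and Z12F: "x \<in> N \<Longrightarrow> Z1 (Z2 F) x = Z2 (Z1 F) x"
    and W1Z11F: "x \<in> N \<Longrightarrow> W1 (Z1 (Z1 F)) x = 2 *s Z1 K x + 8 *s Z1 F x"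
    and W2Z22F: "x \<in> N \<Longrightarrow> W2 (Z2 (Z2 F)) x = 2 *s Z2 K x + 8 *s Z2 F x"
    and W1Z12F: "x \<in> N \<Longrightarrow> W1 (Z1 (Z2 F)) x = Z2 K x" and W1Z21F: "x \<in> N \<Longrightarrow> W1 (Z2 (Z1 F)) x = Z2 K x"
    and W2Z12F: "x \<in> N \<Longrightarrow> W2 (Z1 (Z2 F)) x = Z1 K x" and W2Z21F: "x \<in> N \<Longrightarrow> W2 (Z2 (Z1 F)) x = Z1 K x"
begin

text \<open>The hypotheses are symmetric in the indices 1 and 2, so each lemma below has a twin with
  the indices exchanged.\<close>

lemma swap: "spherical_frame N S Z2 W2 Z1 W1 F K"
  using Z2_diff W2_diff Z1_diff W1_diff
  by unfold_locales (auto intro: FS KS zeroS Z1S Z2S Z1_0 W1_0 Z2_0 W2_0 unit W1F W2F W1Z1F W2Z2F W1Z2F W2Z1F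
      Z12F[symmetric] W1Z11F W2Z22F W1Z12F W1Z21F W2Z12F W2Z21F)

text \<open>Apply \<open>Z1\<close> to \<open>hdot F F = 1\<close>: on the second slot it acts as
  the conjugate field \<open>W1\<close>, which kills \<open>F\<close>. Here and below the zero
  function fills the spare slots of the \<open>_diff\<close> rules.\<close>

lemma Z1F_F: "x \<in> N \<Longrightarrow> hdot (Z1 F x) (F x) = 0"
  using Z1_diff[OF FS FS zeroS zeroS zeroS zeroS, of 1 x] unit
  by (simp add: W1F Z1_0 W1_0)

text \<open>\<open>W1\<close> applied to \<open>Z1F_F\<close>. This ties the length of
  \<open>Z1 F\<close> to \<open>K\<close>, which is common to both indices.\<close>

lemma K_F: "x \<in> N \<Longrightarrow> hdot (K x) (F x) + hdot (Z1 F x) (Z1 F x) = 0"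
  using W1_diff[OF Z1S[OF FS] FS zeroS zeroS zeroS zeroS, of 0 x] Z1F_F
  by (simp add: W1Z1F Z1_0 W1_0)

text \<open>\<open>W2\<close> applied to \<open>Z1F_F\<close>, where \<open>W2 (Z1 F)\<close>
  vanishes.\<close>

lemma Z1F_Z2F: "x \<in> N \<Longrightarrow> hdot (Z1 F x) (Z2 F x) = 0"
  using W2_diff[OF Z1S[OF FS] FS zeroS zeroS zeroS zeroS, of 0 x] Z1F_F
  by (simp add: W2Z1F Z2_0 W2_0)

text \<open>This and the next three lemmas apply \<open>Z1\<close> or \<open>Z2\<close> to the
  orthogonality relations \<open>Z1F_F\<close> and \<open>Z1F_Z2F\<close>. They give components of
  the second derivatives in the frame \<open>F\<close>, \<open>Z1 F\<close>,
  \<open>Z2 F\<close>.\<close>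

lemma Z11F_F: "x \<in> N \<Longrightarrow> hdot (Z1 (Z1 F) x) (F x) = 0"
  using Z1_diff[OF Z1S[OF FS] FS zeroS zeroS zeroS zeroS, of 0 x] Z1F_F
  by (simp add: W1F Z1_0 W1_0)

lemma Z21F_F: "x \<in> N \<Longrightarrow> hdot (Z2 (Z1 F) x) (F x) = 0"
  using Z2_diff[OF Z1S[OF FS] FS zeroS zeroS zeroS zeroS, of 0 x] Z1F_F
  by (simp add: W2F Z2_0 W2_0)

lemma Z11F_Z2F: "x \<in> N \<Longrightarrow> hdot (Z1 (Z1 F) x) (Z2 F x) = 0"
  using Z1_diff[OF Z1S[OF FS] Z2S[OF FS] zeroS zeroS zeroS zeroS, of 0 x] Z1F_Z2F
  by (simp add: W1Z2F Z1_0 W1_0)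

lemma Z21F_Z2F: "x \<in> N \<Longrightarrow> hdot (Z2 (Z1 F) x) (Z2 F x) + hdot (Z1 F x) (K x) = 0"
  using Z2_diff[OF Z1S[OF FS] Z2S[OF FS] zeroS zeroS zeroS zeroS, of 0 x] Z1F_Z2F
  by (simp add: W2Z2F Z2_0 W2_0)

text \<open>\<open>K_F\<close> and its twin share the term \<open>hdot (K x) (F x)\<close>.\<close>

lemma norm_Z1F_Z2F:
  assumes x: "x \<in> N"
  shows "hdot (Z1 F x) (Z1 F x) = hdot (Z2 F x) (Z2 F x)"
proof -
  interpret swapped: spherical_frame N S Z2 W2 Z1 W1 F K
    by (rule swap)
  show ?thesis
    using K_F[OF x] swapped.K_F[OF x] by (metis add_left_cancel)
qed

text \<open>\<open>Z1\<close> applied to \<open>norm_Z1F_Z2F\<close>; on the right,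
  \<open>W1 (Z2 F)\<close> vanishes.\<close>

lemma Z11F_Z1F:
  assumes x: "x \<in> N"
  shows "hdot (Z1 (Z1 F) x) (Z1 F x) + hdot (Z1 F x) (K x) = hdot (Z1 (Z2 F) x) (Z2 F x)"
  using Z1_diff[OF Z1S[OF FS] Z1S[OF FS] zeroS zeroS Z2S[OF FS] Z2S[OF FS], of 0 x] norm_Z1F_Z2F x
  by (simp add: W1Z1F W1Z2F Z1_0 W1_0)

text \<open>Eliminating \<open>K\<close> by \<open>Z21F_Z2F\<close> doubles the right-hand side.
  Squared, this 2 becomes the 4 in the comparison of lengths in \<open>Z1F_eq_0\<close>.\<close>

lemma Z11F_Z1F':
  assumes x: "x \<in> N"
  shows "hdot (Z1 (Z1 F) x) (Z1 F x) = 2 * hdot (Z2 (Z1 F) x) (Z2 F x)"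
  using Z11F_Z1F[OF x] Z21F_Z2F[OF x] by (simp add: Z12F[OF x] add_eq_0_iff)

text \<open>\<open>W1\<close> applied to \<open>Z11F_Z1F\<close>. The term with the 8 enters through
  \<open>W1Z11F\<close>.\<close>

lemma Z1K_Z1F:
  assumes x: "x \<in> N"
  shows "2 * hdot (Z1 K x) (Z1 F x) + 8 * hdot (Z1 F x) (Z1 F x) + hdot (Z1 (Z1 F) x) (Z1 (Z1 F) x)
    + hdot (K x) (K x) + hdot (Z1 F x) (Z1 K x)
    = hdot (Z2 K x) (Z2 F x) + hdot (Z2 (Z1 F) x) (Z2 (Z1 F) x)"
  using W1_diff[OF Z1S[OF Z1S[OF FS]] Z1S[OF FS] Z1S[OF FS] KS Z1S[OF Z2S[OF FS]] Z2S[OF FS], of 0 x]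
    Z11F_Z1F x
  by (simp add: W1Z1F W1Z2F W1Z11F W1Z12F hdot_add_left hdot_scale_left Z12F add.assoc)

text \<open>\<open>W1\<close> applied to \<open>Z21F_Z2F\<close>; it serves to eliminate
  \<open>K\<close> and its derivatives from \<open>Z1K_Z1F\<close>.\<close>

lemma Z2K_Z2F:
  assumes x: "x \<in> N"
  shows "hdot (Z2 K x) (Z2 F x) + hdot (Z2 (Z1 F) x) (Z2 (Z1 F) x) + hdot (K x) (K x)
    + hdot (Z1 F x) (Z1 K x) = 0"
  using W1_diff[OF Z2S[OF Z1S[OF FS]] Z2S[OF FS] Z1S[OF FS] KS zeroS zeroS, of 0 x]
    Z21F_Z2F x
  by (simp add: W1Z1F W1Z2F W1Z21F Z1_0 W1_0 Z12F add.assoc)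

lemma Z1F_eq_0:
  assumes x: "x \<in> N"
  shows "Z1 F x = 0"
proof (rule ccontr)
  assume nz: "Z1 F x \<noteq> 0"
  interpret swapped: spherical_frame N S Z2 W2 Z1 W1 F K
    by (rule swap)
  define L where "L = hdot (Z1 F x) (Z1 F x)"
  have L: "L \<noteq> 0" "hdot (Z2 F x) (Z2 F x) = L"
    using nz norm_Z1F_Z2F[OF x] unfolding L_def hdot_self_eq_0_iff by simp_all
  define e :: "3 \<Rightarrow> complex^3" where
    "e i = (if i = 1 then F x else if i = 2 then Z1 F x else Z2 F x)" for i
  have e: "e 1 = F x" "e 2 = Z1 F x" "e 3 = Z2 F x"
    unfolding e_def by simp_all
  have conj0: "hdot v u = 0" if "hdot u v = 0" for u v :: "complex^3"
    using that cnj_hdot[of u v] by simp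
  note orth = Z1F_F[OF x] swapped.Z1F_F[OF x] Z1F_Z2F[OF x]
  have "hdot v v = (\<Sum>j\<in>UNIV. hdot v (e j) * hdot (e j) v / hdot (e j) (e j))" for v
  proof (rule hdot_parseval)
    show "hdot (e i) (e j) = 0" if "i \<noteq> j" for i j
      using that exhaust_3[of i] exhaust_3[of j] orth orth[THEN conj0] by (auto simp: e)
    show "e i \<noteq> 0" for i
      using exhaust_3[of i] nz L unit[OF x] by (auto simp: e)
  qed
  then have "hdot v v = hdot v (F x) * hdot (F x) v
      + hdot v (Z1 F x) * hdot (Z1 F x) v / L + hdot v (Z2 F x) * hdot (Z2 F x) v / L" for v
    unfolding sum_3 e unit[OF x] L(2) L_def[symmetric] by (simp only: div_by_1)
  then have parseval: "hdot v v * L = hdot v (F x) * hdot (F x) v * L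
      + hdot v (Z1 F x) * hdot (Z1 F x) v + hdot v (Z2 F x) * hdot (Z2 F x) v" for v
    using L(1) by (metis distrib_right nonzero_eq_divide_eq)
  let ?Z11 = "Z1 (Z1 F) x" and ?Z12 = "Z2 (Z1 F) x" and ?Z22 = "Z2 (Z2 F) x"
  note Z21 = Z12F[OF x]
  have conj2: "hdot v u = 2 * hdot v' u'" if "hdot u v = 2 * hdot u' v'" for u v u' v' :: "complex^3"
    using that cnj_hdot[of u v] cnj_hdot[of u' v'] by simp
  \<comment> \<open>Only the component of \<open>?Z11\<close> along \<open>Z1 F\<close> survives,
    and it is twice that of \<open>?Z12\<close> along \<open>Z2 F\<close>.\<close>
  have 11: "hdot ?Z11 ?Z11 * L = 4 * (hdot ?Z12 (Z2 F x) * hdot (Z2 F x) ?Z12)"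
    unfolding parseval Z11F_F[OF x] Z11F_Z2F[OF x] Z11F_Z1F'[OF x] conj2[OF Z11F_Z1F'[OF x]]
    by simp
  have 22: "hdot ?Z22 ?Z22 * L = 4 * (hdot ?Z12 (Z1 F x) * hdot (Z1 F x) ?Z12)"
    using swapped.Z11F_Z1F'[OF x] conj2[OF swapped.Z11F_Z1F'[OF x]]
    unfolding parseval swapped.Z11F_F[OF x] swapped.Z11F_Z2F[OF x] Z21
    by simp
  have 12: "hdot ?Z12 ?Z12 * L = hdot ?Z12 (Z1 F x) * hdot (Z1 F x) ?Z12
      + hdot ?Z12 (Z2 F x) * hdot (Z2 F x) ?Z12"
    unfolding parseval Z21F_F[OF x] by simp
  have "(hdot ?Z11 ?Z11 + hdot ?Z22 ?Z22) * L = 4 * hdot ?Z12 ?Z12 * L"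
    using 11 22 12 by (simp add: distrib_right mult.assoc)
  then have A: "hdot ?Z11 ?Z11 + hdot ?Z22 ?Z22 = 4 * hdot ?Z12 ?Z12"
    using L(1) by simp
  \<comment> \<open>Add \<open>Z1K_Z1F\<close> and its twin, then subtract \<open>Z2K_Z2F\<close>
    and its twin: everything involving \<open>K\<close> cancels, and the two terms
    \<open>8 * L\<close> add up.\<close>
  have "hdot ?Z11 ?Z11 + hdot ?Z22 ?Z22 + 16 * L = 4 * hdot ?Z12 ?Z12"
    using Z1K_Z1F[OF x] swapped.Z1K_Z1F[OF x] Z2K_Z2F[OF x] swapped.Z2K_Z2F[OF x] L(2)
    unfolding Z21 L_def[symmetric] by algebra
  then show False
    using A L(1) by simp
qed

end

section \<open>Derivations along linear vector fields\<close>

text \<open>Both maps agree along a curve in \<open>M\<close> with velocity \<open>v\<close>. Hence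
  equations known on \<open>M\<close> only may be differentiated in tangent directions, and
  different local extensions of a CR map have the same derivative there.\<close>

lemma tangent_space_has_derivative_eq:
  assumes "(f has_derivative f') (at p)" "(g has_derivative g') (at p)"
    and "open U" "p \<in> U" "\<And>x. x \<in> M \<inter> U \<Longrightarrow> f x = g x"
    and "v \<in> tangent_space M p"
  shows "f' v = g' v"
proof -
  obtain \<gamma> :: "real \<Rightarrow> 'a" where \<gamma>: "\<gamma> 0 = p" "\<forall>\<^sub>F t in nhds 0. \<gamma> t \<in> M"
    "(\<gamma> has_vector_derivative v) (at 0)"
    using assms(6) unfolding tangent_space_def by blast
  have "isCont \<gamma> 0"
    using \<gamma>(3) has_vector_derivative_continuous by blast
  then have "\<forall>\<^sub>F t in nhds 0. \<gamma> t \<in> U"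
    using assms(3,4) \<gamma>(1) by (metis isCont_def tendsto_at_iff_tendsto_nhds topological_tendstoD)
  with \<gamma>(2) have ev: "\<forall>\<^sub>F t in nhds 0. f (\<gamma> t) = g (\<gamma> t)"
    by eventually_elim (use assms(5) in auto)
  have f: "((\<lambda>t. f (\<gamma> t)) has_vector_derivative f' v) (at 0)"
    using vector_derivative_diff_chain_within[OF \<gamma>(3), of f f'] assms(1) \<gamma>(1)
    by (simp add: o_def has_derivative_at_withinI)
  have g: "((\<lambda>t. g (\<gamma> t)) has_vector_derivative g' v) (at 0)"
    using vector_derivative_diff_chain_within[OF \<gamma>(3), of g g'] assms(2) \<gamma>(1)
    by (simp add: o_def has_derivative_at_withinI)
  have "\<forall>\<^sub>F t in at 0. f (\<gamma> t) = g (\<gamma> t)"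
    using ev by (rule eventually_nhds_conv_at[THEN iffD1, THEN conjunct1])
  then have "((\<lambda>t. g (\<gamma> t)) has_vector_derivative f' v) (at 0)"
    unfolding has_vector_derivative_def
    by (rule has_derivative_transform_eventually[where g = "\<lambda>t. g (\<gamma> t)",
        OF f[unfolded has_vector_derivative_def] _ eventually_nhds_x_imp_x[OF ev] UNIV_I])
  then show ?thesis
    using g by (rule vector_derivative_unique_at)
qed

lemma tangent_space_image:
  assumes "(h has_derivative h') (at p)" "h ` M \<subseteq> M'" "v \<in> tangent_space M p"
  shows "h' v \<in> tangent_space M' (h p)"
proof -
  obtain \<gamma> :: "real \<Rightarrow> 'a" where \<gamma>: "\<gamma> 0 = p" "\<forall>\<^sub>F t in nhds 0. \<gamma> t \<in> M"
    "(\<gamma> has_vector_derivative v) (at 0)"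
    using assms(3) unfolding tangent_space_def by blast
  have "\<forall>\<^sub>F t in nhds 0. h (\<gamma> t) \<in> M'"
    using \<gamma>(2) by eventually_elim (use assms(2) in auto)
  moreover have "((\<lambda>t. h (\<gamma> t)) has_vector_derivative h' v) (at 0)"
    using vector_derivative_diff_chain_within[OF \<gamma>(3), of h h'] assms(1) \<gamma>(1)
    by (simp add: o_def has_derivative_at_withinI)
  ultimately show ?thesis
    unfolding tangent_space_def using \<gamma>(1) by (intro CollectI exI[of _ "\<lambda>t. h (\<gamma> t)"]) simp
qed

text \<open>Reverse time along the curve. Together with \<open>v = \<i> *s (- (\<i> *s v))\<close>
  this puts \<open>v\<close> into \<open>complex_tangent_space\<close> once \<open>v\<close> and
  \<open>\<i> *s v\<close> are tangent.\<close>

lemma tangent_space_uminus: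
  assumes "v \<in> tangent_space M p"
  shows "- v \<in> tangent_space M p"
proof -
  obtain \<gamma> :: "real \<Rightarrow> 'a" where \<gamma>: "\<gamma> 0 = p" "\<forall>\<^sub>F t in nhds 0. \<gamma> t \<in> M"
    "(\<gamma> has_vector_derivative v) (at 0)"
    using assms unfolding tangent_space_def by blast
  have "filterlim uminus (nhds 0) (nhds (0::real))"
    using tendsto_minus[OF filterlim_ident, of "0::real"] by simp
  then have "\<forall>\<^sub>F t in nhds 0. \<gamma> (- t) \<in> M"
    using \<gamma>(2) eventually_compose_filterlim[of "\<lambda>t. \<gamma> t \<in> M"] by blast
  moreover have "((\<lambda>t. \<gamma> (- t)) has_vector_derivative - v) (at 0)"
  proof -
    have "(uminus has_vector_derivative (- 1)) (at (0::real))"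
      by (auto intro!: derivative_eq_intros)
    then show ?thesis
      using vector_diff_chain_at[of uminus "- 1" 0 \<gamma> v] \<gamma>(3) by (simp add: o_def)
  qed
  ultimately show ?thesis
    unfolding tangent_space_def using \<gamma>(1) by (intro CollectI exI[of _ "\<lambda>t. \<gamma> (- t)"]) simp
qed

lemma tangent_space_open_Int:
  assumes "open U" "p \<in> U" "v \<in> tangent_space M p"
  shows "v \<in> tangent_space (M \<inter> U) p"
proof -
  obtain \<gamma> :: "real \<Rightarrow> 'a" where \<gamma>: "\<gamma> 0 = p" "\<forall>\<^sub>F t in nhds 0. \<gamma> t \<in> M"
    "(\<gamma> has_vector_derivative v) (at 0)"
    using assms(3) unfolding tangent_space_def by blast
  have "isCont \<gamma> 0"
    using \<gamma>(3) has_vector_derivative_continuous by blast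
  then have "\<forall>\<^sub>F t in nhds 0. \<gamma> t \<in> U"
    using assms(1,2) \<gamma>(1) by (metis isCont_def tendsto_at_iff_tendsto_nhds topological_tendstoD)
  with \<gamma>(2) have "\<forall>\<^sub>F t in nhds 0. \<gamma> t \<in> M \<inter> U"
    by eventually_elim simp
  then show ?thesis
    unfolding tangent_space_def using \<gamma> by blast
qed

section \<open>Real and complex derivations along linear fields\<close>

definition field_deriv :: "('a \<Rightarrow> 'a) \<Rightarrow> ('a::real_normed_vector \<Rightarrow> 'b::real_normed_vector) \<Rightarrow> 'a \<Rightarrow> 'b"
  where "field_deriv A f x = frechet_derivative f (at x) (A x)"

lemma smooth_on_field_deriv:
  fixes f :: "'a::euclidean_space \<Rightarrow> 'b::real_normed_vector"
  assumes U: "open U" and A: "linear A" and f: "smooth_on U f"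
  shows "smooth_on U (field_deriv A f)"
proof (rule smooth_on_cong[OF U])
  show "(\<Sum>i\<in>Basis. (A x \<bullet> i) *\<^sub>R frechet_derivative f (at x) i) = field_deriv A f x"
    if "x \<in> U" for x
    unfolding field_deriv_def
    by (rule linear_euclidean_expansion[OF has_derivative_linear[OF
      smooth_on_has_derivative[OF f that]], symmetric])
  have bl: "bounded_linear (\<lambda>x. A x \<bullet> i)" for i
    using bounded_linear_compose[OF bounded_linear_inner_left linear_conv_bounded_linear[THEN iffD1, OF A]] .
  show "smooth_on U (\<lambda>x. \<Sum>i\<in>Basis. (A x \<bullet> i) *\<^sub>R frechet_derivative f (at x) i)"
    by (intro smooth_on_sum[OF U] smooth_on_bilinear[OF bounded_bilinear_scaleR U]
        smooth_on_linear[OF bl U] smooth_on_frechet_derivative[OF f])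
qed

text \<open>Differentiating the direction field \<open>B\<close> along \<open>A\<close> gives
  \<open>B \<circ> A\<close>, since a linear map is its own derivative; the other term is the
  Hessian of \<open>f\<close> on \<open>A x\<close> and \<open>B x\<close>.\<close>

lemma field_deriv_field_deriv:
  fixes f :: "'a::euclidean_space \<Rightarrow> 'b::euclidean_space"
  assumes U: "open U" "x \<in> U" and B: "linear B" and f: "smooth_on U f"
  shows "field_deriv A (field_deriv B f) x =
    field_deriv (B \<circ> A) f x + frechet_derivative (\<lambda>z. frechet_derivative f (at z) (A x)) (at x) (B x)"
proof -
  have exp: "field_deriv B f z = (\<Sum>i\<in>Basis. (B z \<bullet> i) *\<^sub>R frechet_derivative f (at z) i)" if "z \<in> U" for z
    unfolding field_deriv_def
    by (rule linear_euclidean_expansion[OF has_derivative_linear[OF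
      smooth_on_has_derivative[OF f that]]])
  have bl: "bounded_linear (\<lambda>x. B x \<bullet> i)" for i
    using bounded_linear_compose[OF bounded_linear_inner_left linear_conv_bounded_linear[THEN iffD1, OF B]] .
  let ?D = "\<lambda>i. frechet_derivative (\<lambda>z. frechet_derivative f (at z) i) (at x)"
  have "((\<lambda>z. \<Sum>i\<in>Basis. (B z \<bullet> i) *\<^sub>R frechet_derivative f (at z) i) has_derivative
      (\<lambda>v. \<Sum>i\<in>Basis. (B x \<bullet> i) *\<^sub>R ?D i v + (B v \<bullet> i) *\<^sub>R frechet_derivative f (at x) i)) (at x)"
    by (intro has_derivative_sum bounded_bilinear.FDERIV[OF bounded_bilinear_scaleR]
        bounded_linear_imp_has_derivative[OF bl]
        smooth_on_has_derivative[OF smooth_on_frechet_derivative[OF f] U(2)])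
  then have "(field_deriv B f has_derivative
      (\<lambda>v. \<Sum>i\<in>Basis. (B x \<bullet> i) *\<^sub>R ?D i v + (B v \<bullet> i) *\<^sub>R frechet_derivative f (at x) i)) (at x)"
    by (rule has_derivative_transform_within_open[OF _ U]) (simp add: exp)
  then have "field_deriv A (field_deriv B f) x =
      (\<Sum>i\<in>Basis. (B x \<bullet> i) *\<^sub>R ?D i (A x) + (B (A x) \<bullet> i) *\<^sub>R frechet_derivative f (at x) i)"
    unfolding field_deriv_def[of A] by (simp add: frechet_derivative_at[symmetric])
  also have "\<dots> = (\<Sum>i\<in>Basis. (B x \<bullet> i) *\<^sub>R ?D (A x) i)
      + (\<Sum>i\<in>Basis. (B (A x) \<bullet> i) *\<^sub>R frechet_derivative f (at x) i)"
    by (simp only: sum.distrib mixed_derivatives_commute[OF U f, of _ "A x"])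
  also have "(\<Sum>i\<in>Basis. (B x \<bullet> i) *\<^sub>R ?D (A x) i) = ?D (A x) (B x)"
    by (rule linear_euclidean_expansion[OF has_derivative_linear[OF
      smooth_on_has_derivative[OF smooth_on_frechet_derivative[OF f] U(2)]], symmetric])
  also have "(\<Sum>i\<in>Basis. (B (A x) \<bullet> i) *\<^sub>R frechet_derivative f (at x) i) = field_deriv (B \<circ> A) f x"
    unfolding field_deriv_def o_def
    by (rule linear_euclidean_expansion[OF has_derivative_linear[OF
      smooth_on_has_derivative[OF f U(2)]], symmetric])
  finally show ?thesis
    by (simp only: add.commute)
qed

text \<open>The Hessian terms cancel by symmetry. The bracket of linear fields is minus the
  commutator of their matrices, whence the order in \<open>B (A x) - A (B x)\<close>.\<close>

lemma field_deriv_commutator: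
  fixes f :: "'a::euclidean_space \<Rightarrow> 'b::euclidean_space"
  assumes U: "open U" "x \<in> U" and AB: "linear A" "linear B" and f: "smooth_on U f"
  shows "field_deriv A (field_deriv B f) x =
    field_deriv B (field_deriv A f) x + frechet_derivative f (at x) (B (A x) - A (B x))"
  using linear_diff[OF has_derivative_linear[OF smooth_on_has_derivative[OF f U(2)]], of "B (A x)" "A (B x)"]
  by (simp add: field_deriv_field_deriv[OF U AB(1) f] field_deriv_field_deriv[OF U AB(2) f]
      mixed_derivatives_commute[OF U f, of "A x"] field_deriv_def[where A = "_ \<circ> _"])

lemma bounded_linear_vector_scalar_mult: "bounded_linear ((*s) (c::complex) :: complex^'n \<Rightarrow> _)"
proof -
  have "linear ((*s) c :: complex^'n \<Rightarrow> _)"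
    by (rule linearI) (simp_all add: vec_eq_iff algebra_simps)
  then show ?thesis
    by (simp add: linear_conv_bounded_linear)
qed

text \<open>With \<open>c = -\<i>\<close> and \<open>c = \<i>\<close> this is, up to a factor 2, the complex derivation of type \<open>(1,0)\<close>
  and its conjugate.\<close>

definition complex_deriv ::
    "complex \<Rightarrow> ('a \<Rightarrow> 'a) \<Rightarrow> ('a \<Rightarrow> 'a) \<Rightarrow> ('a::real_normed_vector \<Rightarrow> complex^'n) \<Rightarrow> 'a \<Rightarrow> complex^'n"
  where "complex_deriv c X Y f x = field_deriv X f x + c *s field_deriv Y f x"

lemma smooth_on_complex_deriv:
  fixes f :: "'a::euclidean_space \<Rightarrow> complex^'n"
  assumes "open U" "linear X" "linear Y" "smooth_on U f"
  shows "smooth_on U (complex_deriv c X Y f)"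
  unfolding complex_deriv_def[abs_def]
  by (intro smooth_on_add smooth_on_bounded_linear[OF bounded_linear_vector_scalar_mult]
      smooth_on_field_deriv assms)

lemma field_deriv_scale:
  fixes f :: "'a::euclidean_space \<Rightarrow> complex^'n"
  assumes "smooth_on U f" "x \<in> U"
  shows "field_deriv A (\<lambda>z. c *s f z) x = c *s field_deriv A f x"
  unfolding field_deriv_def
  using frechet_derivative_bounded_linear[OF bounded_linear_vector_scalar_mult
      smooth_on_differentiable[OF assms], of c] by simp

lemma field_deriv_complex_deriv:
  fixes f :: "'a::euclidean_space \<Rightarrow> complex^'n"
  assumes U: "open U" "x \<in> U" and XY: "linear X" "linear Y" and f: "smooth_on U f"
  shows "field_deriv A (complex_deriv c X Y f) x =
    field_deriv A (field_deriv X f) x + c *s field_deriv A (field_deriv Y f) x"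
proof -
  note sX = smooth_on_field_deriv[OF U(1) XY(1) f] and sY = smooth_on_field_deriv[OF U(1) XY(2) f]
  have "(complex_deriv c X Y f has_derivative
      (\<lambda>v. frechet_derivative (field_deriv X f) (at x) v
        + c *s frechet_derivative (field_deriv Y f) (at x) v)) (at x)"
    unfolding complex_deriv_def[abs_def]
    by (intro has_derivative_add smooth_on_has_derivative[OF sX U(2)]
        bounded_linear.has_derivative[OF bounded_linear_vector_scalar_mult]
        smooth_on_has_derivative[OF sY U(2)])
  then show ?thesis
    unfolding field_deriv_def[of A] by (simp add: frechet_derivative_at[symmetric])
qed

lemma field_deriv_cong_tangent:
  assumes "smooth_on U f" "smooth_on U g" "p \<in> N" "N \<subseteq> U" "\<And>x. x \<in> N \<Longrightarrow> f x = g x"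
    and "A p \<in> tangent_space N p"
  shows "field_deriv A f p = field_deriv A g p"
  unfolding field_deriv_def
proof (rule tangent_space_has_derivative_eq[where U = UNIV and M = N and p = p and f = f and g = g])
  show "(f has_derivative frechet_derivative f (at p)) (at p)"
    "(g has_derivative frechet_derivative g (at p)) (at p)"
    using assms(3,4) by (auto intro: smooth_on_has_derivative[OF assms(1)] smooth_on_has_derivative[OF assms(2)])
qed (use assms in auto)

lemma complex_deriv_cong_tangent:
  assumes "smooth_on U f" "smooth_on U g" "p \<in> N" "N \<subseteq> U" "\<And>x. x \<in> N \<Longrightarrow> f x = g x"
    and "X p \<in> tangent_space N p" "Y p \<in> tangent_space N p"
  shows "complex_deriv c X Y f p = complex_deriv c X Y g p"
  unfolding complex_deriv_def
  using field_deriv_cong_tangent[OF assms(1-5)] assms(6,7) by auto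

text \<open>Product rule along \<open>X\<close> and \<open>Y\<close>, combined with the coefficient
  \<open>c\<close>, which is conjugated on entering the second slot. Tangency of \<open>X p\<close>
  and \<open>Y p\<close> allows the identity to be given on \<open>N\<close> only.\<close>

lemma complex_deriv_hdot:
  fixes u v u' v' u'' v'' :: "'a::euclidean_space \<Rightarrow> complex^'n"
  assumes s: "smooth_on U u" "smooth_on U v" "smooth_on U u'" "smooth_on U v'"
      "smooth_on U u''" "smooth_on U v''"
    and N: "N \<subseteq> U" "p \<in> N"
    and eq: "\<And>x. x \<in> N \<Longrightarrow> hdot (u x) (v x) + hdot (u' x) (v' x) = hdot (u'' x) (v'' x) + k"
    and tan: "X p \<in> tangent_space N p" "Y p \<in> tangent_space N p"
  shows "hdot (complex_deriv c X Y u p) (v p) + hdot (u p) (complex_deriv (cnj c) X Y v p)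
      + (hdot (complex_deriv c X Y u' p) (v' p) + hdot (u' p) (complex_deriv (cnj c) X Y v' p))
    = hdot (complex_deriv c X Y u'' p) (v'' p) + hdot (u'' p) (complex_deriv (cnj c) X Y v'' p)"
proof -
  have p: "p \<in> U" using N by blast
  note d = smooth_on_has_derivative[OF _ p]
  let ?D = "\<lambda>u. frechet_derivative u (at p)"
  note B = bounded_bilinear.FDERIV[OF bounded_bilinear_hdot]
  have A: "hdot (u p) (?D v w) + hdot (?D u w) (v p) + (hdot (u' p) (?D v' w) + hdot (?D u' w) (v' p))
      = hdot (u'' p) (?D v'' w) + hdot (?D u'' w) (v'' p) + 0" if "w \<in> tangent_space N p" for w
    by (rule tangent_space_has_derivative_eq[OF
      has_derivative_add[OF B[OF d d] B[OF d d]] has_derivative_add[OF B[OF d d] has_derivative_const]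
      open_UNIV UNIV_I _ that]) (use s eq in auto)
  show ?thesis
    using A[OF tan(1)] A[OF tan(2)]
    unfolding complex_deriv_def field_deriv_def hdot_add_left hdot_add_right hdot_scale_left hdot_scale_right
      complex_cnj_cnj by algebra
qed

lemma complex_deriv_commute:
  fixes f :: "'a::euclidean_space \<Rightarrow> complex^'n"
  assumes U: "open U" "x \<in> U" and f: "smooth_on U f"
    and lin: "linear X" "linear Y" "linear X'" "linear Y'"
    and comm: "X (X' x) = X' (X x)" "X (Y' x) = Y' (X x)" "Y (X' x) = X' (Y x)" "Y (Y' x) = Y' (Y x)"
  shows "complex_deriv c X Y (complex_deriv d X' Y' f) x = complex_deriv d X' Y' (complex_deriv c X Y f) x"
proof -
  note ex = field_deriv_complex_deriv[OF U _ _ f]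
  have zero: "frechet_derivative f (at x) 0 = 0"
    by (rule linear_0[OF has_derivative_linear[OF smooth_on_has_derivative[OF f U(2)]]])
  note co = field_deriv_commutator[OF U _ _ f]
  show ?thesis
    unfolding complex_deriv_def[of _ _ _ "complex_deriv _ _ _ _"] ex[OF lin(1,2)] ex[OF lin(3,4)]
      co[OF lin(1,3)] co[OF lin(1,4)] co[OF lin(2,3)] co[OF lin(2,4)] comm
    by (simp add: zero vector_add_ldistrib vector_smult_assoc mult.commute add_ac)
qed

text \<open>The products of distinct imaginary quaternion units. Squares are left out, as they
  differ from -1 for fields acting on one factor of a product only. The brackets are
  \<open>[X, Y] = -2 T\<close> and its cyclic shifts.\<close>

definition su2_fields :: "('a::real_vector \<Rightarrow> 'a) \<Rightarrow> ('a \<Rightarrow> 'a) \<Rightarrow> ('a \<Rightarrow> 'a) \<Rightarrow> bool" where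
  "su2_fields X Y T \<longleftrightarrow> linear X \<and> linear Y \<and> linear T \<and>
    (\<forall>p. X (Y p) = T p \<and> Y (X p) = - T p \<and> Y (T p) = X p \<and> T (Y p) = - X p \<and>
      T (X p) = Y p \<and> X (T p) = - Y p)"

text \<open>The bracket of \<open>X + \<i> Y\<close> and \<open>X - \<i> Y\<close> is
  \<open>-2 \<i> [X, Y] = 4 \<i> T\<close>.\<close>

lemma su2_complex_deriv_commutator:
  fixes f :: "'a::euclidean_space \<Rightarrow> complex^'n"
  assumes U: "open U" "x \<in> U" and f: "smooth_on U f" and su2: "su2_fields X Y T"
  shows "complex_deriv \<i> X Y (complex_deriv (-\<i>) X Y f) x =
    complex_deriv (-\<i>) X Y (complex_deriv \<i> X Y f) x + (4 * \<i>) *s field_deriv T f x"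
proof -
  have lin: "linear X" "linear Y" "linear T" and
    rel: "X (Y x) = T x" "Y (X x) = - T x"
    using su2 unfolding su2_fields_def by auto
  note ex = field_deriv_complex_deriv[OF U lin(1,2) f]
  have "Y (X x) - X (Y x) = (- 2) *\<^sub>R T x"
    unfolding rel scaleR_minus_left scaleR_2 by simp
  then have "frechet_derivative f (at x) (Y (X x) - X (Y x)) = (- 2) *\<^sub>R field_deriv T f x"
    unfolding field_deriv_def
    by (simp only: linear_cmul[OF has_derivative_linear[OF smooth_on_has_derivative[OF f U(2)]]])
  then have co: "field_deriv X (field_deriv Y f) x =
      field_deriv Y (field_deriv X f) x + (- 2) *\<^sub>R field_deriv T f x"
    using field_deriv_commutator[OF U lin(1,2) f] by simp
  show ?thesis
    unfolding complex_deriv_def[of _ _ _ "complex_deriv _ _ _ _"] ex co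
    by (simp add: vec_eq_iff) (simp add: algebra_simps scaleR_conv_of_real)
qed

text \<open>From \<open>[T, X] = -2 Y\<close> and \<open>[T, Y] = 2 X\<close>, the derivation
  \<open>X - \<i> Y\<close> is an eigenvector of the bracket with \<open>T\<close>, with eigenvalue
  \<open>-2 \<i>\<close>.\<close>

lemma su2_field_deriv_commutator:
  fixes f :: "'a::euclidean_space \<Rightarrow> complex^'n"
  assumes U: "open U" "x \<in> U" and f: "smooth_on U f" and su2: "su2_fields X Y T"
  shows "field_deriv T (complex_deriv (-\<i>) X Y f) x =
    complex_deriv (-\<i>) X Y (field_deriv T f) x + (- 2 * \<i>) *s complex_deriv (-\<i>) X Y f x"
proof -
  have lin: "linear X" "linear Y" "linear T" and
    rel: "Y (T x) = X x" "T (Y x) = - X x" "T (X x) = Y x" "X (T x) = - Y x"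
    using su2 unfolding su2_fields_def by auto
  note ex = field_deriv_complex_deriv[OF U lin(1,2) f]
  note cmul = linear_cmul[OF has_derivative_linear[OF smooth_on_has_derivative[OF f U(2)]]]
  have "Y (T x) - T (Y x) = 2 *\<^sub>R X x" "X (T x) - T (X x) = (- 2) *\<^sub>R Y x"
    unfolding rel scaleR_minus_left scaleR_2 by simp_all
  then have co: "field_deriv T (field_deriv Y f) x =
      field_deriv Y (field_deriv T f) x + 2 *\<^sub>R field_deriv X f x"
      "field_deriv T (field_deriv X f) x =
      field_deriv X (field_deriv T f) x + (- 2) *\<^sub>R field_deriv Y f x"
    using field_deriv_commutator[OF U lin(3,2) f] field_deriv_commutator[OF U lin(3,1) f]
    unfolding field_deriv_def[of X f] field_deriv_def[of Y f] by (simp_all only: cmul)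
  show ?thesis
    unfolding ex co complex_deriv_def
    by (simp add: vec_eq_iff) (simp add: algebra_simps scaleR_conv_of_real)
qed

section \<open>Maps to the sphere lifted to a circle bundle\<close>

text \<open>The field \<open>T1 - T2\<close> spans the fibres of the circle bundle \<open>N\<close> over the CR hypersurface; \<open>F\<close> is
  the lift of an extension of a CR map, so the equations for \<open>F\<close> other than \<open>fibre\<close> hold on \<open>N\<close> only.\<close>

locale lifted_sphere_map =
  fixes U N :: "'a::euclidean_space set" and X1 Y1 T1 X2 Y2 T2 :: "'a \<Rightarrow> 'a"
    and F :: "'a \<Rightarrow> complex^3"
  assumes U: "open U" and N: "N \<subseteq> U" and F: "smooth_on U F"
    and su2: "su2_fields X1 Y1 T1" "su2_fields X2 Y2 T2"
    and comm: "A \<in> {X1, Y1, T1} \<Longrightarrow> B \<in> {X2, Y2, T2} \<Longrightarrow> A (B p) = B (A p)"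
    and tangent: "A \<in> {X1, Y1, T1, X2, Y2, T2} \<Longrightarrow> p \<in> N \<Longrightarrow> A p \<in> tangent_space N p"
    and unit: "p \<in> N \<Longrightarrow> hdot (F p) (F p) = 1"
    and CR1: "p \<in> N \<Longrightarrow> complex_deriv \<i> X1 Y1 F p = 0"
    and CR2: "p \<in> N \<Longrightarrow> complex_deriv \<i> X2 Y2 F p = 0"
    and fibre: "p \<in> U \<Longrightarrow> field_deriv T1 F p = field_deriv T2 F p"
begin

abbreviation "Z1 \<equiv> complex_deriv (-\<i>) X1 Y1 :: ('a \<Rightarrow> complex^3) \<Rightarrow> _"
abbreviation "W1 \<equiv> complex_deriv \<i> X1 Y1 :: ('a \<Rightarrow> complex^3) \<Rightarrow> _"
abbreviation "Z2 \<equiv> complex_deriv (-\<i>) X2 Y2 :: ('a \<Rightarrow> complex^3) \<Rightarrow> _"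
abbreviation "W2 \<equiv> complex_deriv \<i> X2 Y2 :: ('a \<Rightarrow> complex^3) \<Rightarrow> _"

text \<open>Equal to \<open>W1 (Z1 F)\<close> on \<open>N\<close>, but written through
  \<open>T1\<close> so that \<open>fibre\<close> gives the same function on \<open>U\<close> for
  both indices.\<close>

definition K where "K p = (4 * \<i>) *s field_deriv T1 F p"

lemma swap: "lifted_sphere_map U N X2 Y2 T2 X1 Y1 T1 F"
  by unfold_locales
    (use U N F su2 comm tangent unit CR1 CR2 fibre in \<open>simp_all add: insert_commute\<close>)

lemma lin: "linear X1" "linear Y1" "linear T1" "linear X2" "linear Y2" "linear T2"
  using su2 unfolding su2_fields_def by auto

lemmas smooths = smooth_on_complex_deriv[OF U lin(1,2)] smooth_on_complex_deriv[OF U lin(4,5)]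

lemma smooth_K: "smooth_on U K"
  unfolding K_def[abs_def]
  by (intro smooth_on_bounded_linear[OF bounded_linear_vector_scalar_mult U] smooth_on_field_deriv U lin F)

lemma commute:
  fixes f :: "'a \<Rightarrow> complex^3"
  shows "smooth_on U f \<Longrightarrow> p \<in> U \<Longrightarrow> complex_deriv c X1 Y1 (complex_deriv d X2 Y2 f) p
    = complex_deriv d X2 Y2 (complex_deriv c X1 Y1 f) p"
  by (rule complex_deriv_commute[OF U _ _ lin(1,2,4,5)]) (assumption | rule comm; simp)+

lemma cong1:
  fixes f :: "'a \<Rightarrow> complex^3"
  assumes "smooth_on U f" "smooth_on U g" "p \<in> N" "\<And>x. x \<in> N \<Longrightarrow> f x = g x"
  shows "complex_deriv c X1 Y1 f p = complex_deriv c X1 Y1 g p"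
  by (rule complex_deriv_cong_tangent[OF assms(1,2,3) N assms(4)]) (use assms(3) tangent in auto)

lemma deriv_zero: "complex_deriv c X Y (\<lambda>x. 0) = (\<lambda>x. 0)"
  by (simp add: complex_deriv_def[abs_def] field_deriv_def)

lemma smooth_zero: "smooth_on U (\<lambda>x. 0)"
  by (simp add: smooth_on_def Ck_on_const)

lemma zero1:
  fixes f :: "'a \<Rightarrow> complex^3"
  assumes "smooth_on U f" "p \<in> N" "\<And>x. x \<in> N \<Longrightarrow> f x = 0"
  shows "complex_deriv c X1 Y1 f p = 0"
  using cong1[OF assms(1) smooth_zero assms(2,3), of c] by (simp add: deriv_zero)

lemma W1Z1F:
  assumes p: "p \<in> N"
  shows "W1 (Z1 F) p = K p"
proof -
  have "W1 (Z1 F) p = Z1 (W1 F) p + K p"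
    unfolding K_def using su2_complex_deriv_commutator[OF U _ F su2(1)] N p by blast
  then show ?thesis
    using zero1[OF smooths(1)[OF F] p CR1] by simp
qed

text \<open>\<open>W1\<close> and \<open>Z2\<close> commute, and \<open>W1 F\<close> vanishes on
  \<open>N\<close>, to which the fields of \<open>Z2\<close> are tangent.\<close>

lemma W1Z2F:
  assumes p: "p \<in> N"
  shows "W1 (Z2 F) p = 0"
proof -
  interpret swapped: lifted_sphere_map U N X2 Y2 T2 X1 Y1 T1 F
    by (rule swap)
  show ?thesis
    using commute[OF F] swapped.zero1[OF smooths(1)[OF F] p CR1] p N by auto
qed

text \<open>Moving \<open>W1\<close> past the outer \<open>Z1\<close> leaves one \<open>Z1 K\<close>
  from the inner commutator and one from the outer; moving \<open>T1\<close> past \<open>Z1\<close>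
  adds the coefficient \<open>4 \<i> * (- 2 \<i>) = 8\<close>.\<close>

lemma W1Z11F:
  assumes p: "p \<in> N"
  shows "W1 (Z1 (Z1 F)) p = 2 *s Z1 K p + 8 *s Z1 F p"
proof -
  have pU: "p \<in> U" using p N by auto
  have "W1 (Z1 (Z1 F)) p = Z1 (W1 (Z1 F)) p + (4 * \<i>) *s field_deriv T1 (Z1 F) p"
    by (rule su2_complex_deriv_commutator[OF U pU smooths(1)[OF F] su2(1)])
  also have "Z1 (W1 (Z1 F)) p = Z1 K p"
    by (rule cong1[OF smooths(1)[OF smooths(1)[OF F]] smooth_K p W1Z1F])
  also have "field_deriv T1 (Z1 F) p = Z1 (field_deriv T1 F) p + (- 2 * \<i>) *s Z1 F p"
    by (rule su2_field_deriv_commutator[OF U pU F su2(1)])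
  also have "(4 * \<i>) *s (Z1 (field_deriv T1 F) p + (- 2 * \<i>) *s Z1 F p) = Z1 K p + 8 *s Z1 F p"
  proof -
    have "field_deriv A K p = (4 * \<i>) *s field_deriv A (field_deriv T1 F) p" for A
      unfolding K_def[abs_def]
      by (rule field_deriv_scale[OF smooth_on_field_deriv[OF U lin(3) F] pU])
    then show ?thesis
      unfolding complex_deriv_def by (simp add: vec_eq_iff algebra_simps)
  qed
  finally show ?thesis
    by (simp add: vec_eq_iff)
qed

lemma W1Z21F:
  assumes p: "p \<in> N"
  shows "W1 (Z2 (Z1 F)) p = Z2 K p"
proof -
  interpret swapped: lifted_sphere_map U N X2 Y2 T2 X1 Y1 T1 F
    by (rule swap)
  have "W1 (Z2 (Z1 F)) p = Z2 (W1 (Z1 F)) p"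
    using commute[OF smooths(1)[OF F]] p N by auto
  also have "\<dots> = Z2 K p"
    by (rule swapped.cong1[OF smooths(1)[OF smooths(1)[OF F]] smooth_K p W1Z1F])
  finally show ?thesis .
qed

lemma W1Z12F:
  assumes p: "p \<in> N"
  shows "W1 (Z1 (Z2 F)) p = Z2 K p"
proof -
  have "W1 (Z1 (Z2 F)) p = W1 (Z2 (Z1 F)) p"
  proof (rule cong1[OF smooths(1)[OF smooths(2)[OF F]] smooths(2)[OF smooths(1)[OF F]] p])
    show "Z1 (Z2 F) x = Z2 (Z1 F) x" if "x \<in> N" for x
      using commute[OF F] that N by auto
  qed
  then show ?thesis
    using W1Z21F[OF p] by simp
qed

sublocale spherical_frame N "{f. smooth_on U f}" Z1 W1 Z2 W2 F K
proof -
  interpret swapped: lifted_sphere_map U N X2 Y2 T2 X1 Y1 T1 F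
    by (rule swap)
  \<comment> \<open>\<open>swapped.K\<close> is built from \<open>T2\<close>; \<open>fibre\<close>
    identifies it with \<open>K\<close>.\<close>
  have K: "swapped.K p = K p" if "p \<in> N" for p
    unfolding K_def swapped.K_def using fibre N that by auto
  have Z1K: "Z1 swapped.K p = Z1 K p" if "p \<in> N" for p
    by (rule cong1[OF swapped.smooth_K smooth_K that K])
  have Z2K: "Z2 swapped.K p = Z2 K p" if "p \<in> N" for p
    by (rule swapped.cong1[OF swapped.smooth_K smooth_K that K])
  note hdot1 = complex_deriv_hdot[where U = U and N = N and X = X1 and Y = Y1]
    and hdot2 = complex_deriv_hdot[where U = U and N = N and X = X2 and Y = Y2]
  show "spherical_frame N {f. smooth_on U f} Z1 W1 Z2 W2 F K"
  proof
    show "Z1 (Z2 F) x = Z2 (Z1 F) x" if "x \<in> N" for x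
      using commute[OF F] that N by auto
  next
    fix u v u' v' u'' v'' :: "'a \<Rightarrow> complex^3" and c x
    assume s: "u \<in> {f. smooth_on U f}" "v \<in> {f. smooth_on U f}" "u' \<in> {f. smooth_on U f}"
        "v' \<in> {f. smooth_on U f}" "u'' \<in> {f. smooth_on U f}" "v'' \<in> {f. smooth_on U f}"
      and eq: "\<And>x. x \<in> N \<Longrightarrow> hdot (u x) (v x) + hdot (u' x) (v' x) = hdot (u'' x) (v'' x) + c"
      and x: "x \<in> N"
    note s' = s[unfolded mem_Collect_eq]
    have t: "X1 x \<in> tangent_space N x" "Y1 x \<in> tangent_space N x"
      "X2 x \<in> tangent_space N x" "Y2 x \<in> tangent_space N x"
      using tangent x by auto
    show "hdot (Z1 u x) (v x) + hdot (u x) (W1 v x) + (hdot (Z1 u' x) (v' x) + hdot (u' x) (W1 v' x))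
        = hdot (Z1 u'' x) (v'' x) + hdot (u'' x) (W1 v'' x)"
      using hdot1[OF s' N x eq t(1,2), of "-\<i>"] by simp
    show "hdot (W1 u x) (v x) + hdot (u x) (Z1 v x) + (hdot (W1 u' x) (v' x) + hdot (u' x) (Z1 v' x))
        = hdot (W1 u'' x) (v'' x) + hdot (u'' x) (Z1 v'' x)"
      using hdot1[OF s' N x eq t(1,2), of "\<i>"] by simp
    show "hdot (Z2 u x) (v x) + hdot (u x) (W2 v x) + (hdot (Z2 u' x) (v' x) + hdot (u' x) (W2 v' x))
        = hdot (Z2 u'' x) (v'' x) + hdot (u'' x) (W2 v'' x)"
      using hdot2[OF s' N x eq t(3,4), of "-\<i>"] by simp
    show "hdot (W2 u x) (v x) + hdot (u x) (Z2 v x) + (hdot (W2 u' x) (v' x) + hdot (u' x) (Z2 v' x))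
        = hdot (W2 u'' x) (v'' x) + hdot (u'' x) (Z2 v'' x)"
      using hdot2[OF s' N x eq t(3,4), of "\<i>"] by simp
  qed (use F smooth_K smooth_zero smooths deriv_zero unit CR1 CR2 W1Z1F W1Z2F W1Z11F W1Z21F W1Z12F
      swapped.W1Z1F swapped.W1Z2F swapped.W1Z11F swapped.W1Z21F swapped.W1Z12F K Z1K Z2K in simp_all)
qed

lemma X1_F_eq_0:
  assumes p: "p \<in> N"
  shows "field_deriv X1 F p = 0"
proof -
  have "complex_deriv (-\<i>) X1 Y1 F p + complex_deriv \<i> X1 Y1 F p = 0"
    by (simp add: Z1F_eq_0[OF p] CR1[OF p])
  then show ?thesis
    by (simp add: complex_deriv_def vec_eq_iff)
qed

end

section \<open>The link of the quadric cone\<close>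

lemma norm_vec4: "(norm (w :: complex^4))\<^sup>2 =
    (cmod (w$1))\<^sup>2 + (cmod (w$2))\<^sup>2 + (cmod (w$3))\<^sup>2 + (cmod (w$4))\<^sup>2"
  by (simp add: norm_vec_def L2_set_def sum_nonneg sum_4)

text \<open>The unit vectors in the affine cone over the Segre quadric, the image of the product of
  two projective lines.\<close>

definition segre_link :: "(complex^4) set" where
  "segre_link = {w. norm w = 1 \<and> w$1 * w$4 = w$2 * w$3}"

lemma frontier_eq_segre_link:
  fixes V G :: "(complex^4) set"
  assumes "V = {w. w$1 * w$4 = w$2 * w$3}" and "G = {w. norm w < 1 \<and> w$1 * w$4 = w$2 * w$3}"
  shows "(top_of_set V) frontier_of G = segre_link"
proof -
  have G: "G = V \<inter> ball 0 1"
    using assms by auto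
  then have "openin (top_of_set V) G"
    by (simp add: openin_open_Int)
  then have "(top_of_set V) frontier_of G = (V \<inter> closure G) - G"
    by (simp add: frontier_of_def interior_of_openin closure_of_subtopology G Int_assoc[symmetric])
  also have "\<dots> = segre_link"
  proof (intro equalityI subsetI)
    fix w assume w: "w \<in> (V \<inter> closure G) - G"
    have "closure G \<subseteq> cball 0 1"
      by (rule closure_minimal) (auto simp: G)
    then show "w \<in> segre_link"
      using w unfolding assms segre_link_def by force
  next
    fix w assume w: "w \<in> segre_link"
    \<comment> \<open>\<open>V\<close> is a cone, so the points \<open>t *\<^sub>R w\<close> with
      \<open>0 < t < 1\<close> lie in \<open>G\<close> and approach \<open>w\<close>.\<close>
    have lim: "((\<lambda>t::real. t *\<^sub>R w) \<longlongrightarrow> 1 *\<^sub>R w) (at_left 1)"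
      by (intro tendsto_intros)
    have "\<forall>\<^sub>F t::real in at_left 1. t \<in> {0<..<1}"
      by (rule eventually_at_left_real) simp
    then have "\<forall>\<^sub>F t::real in at_left 1. t *\<^sub>R w \<in> G"
      by eventually_elim (use w in \<open>auto simp: assms segre_link_def\<close>)
    then have "\<forall>\<^sub>F t::real in at_left 1. t *\<^sub>R w \<in> closure G"
      by (rule eventually_mono) (use closure_subset in auto)
    then have "w \<in> closure G"
      using Lim_in_closed_set[OF closed_closure _ trivial_limit_at_left_real lim] by simp
    then show "w \<in> (V \<inter> closure G) - G"
      using w by (auto simp: assms segre_link_def)
  qed
  finally show ?thesis .
qed

section \<open>Complex-linear symmetries as CR automorphisms\<close>

text \<open>\<open>A\<close> is a global smooth extension of \<open>f\<close> and its own
  derivative. \<open>f\<close> is kept apart from \<open>A\<close> because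
  \<open>inv_into M A\<close> is known to be linear on \<open>M\<close> only.\<close>

lemma CR_map_linear:
  fixes A :: "complex^'n \<Rightarrow> complex^'m"
  assumes A: "linear A" "\<And>c x. A (c *s x) = c *s A x"
    and f: "f ` M \<subseteq> N" "\<And>x. x \<in> M \<Longrightarrow> f x = A x"
  shows "CR_map M N f"
proof -
  have bl: "bounded_linear A"
    using A(1) by (simp add: linear_conv_bounded_linear)
  have smooth: "smooth_on UNIV A"
    by (rule smooth_on_linear[OF bl open_UNIV])
  have d: "(A has_derivative A) (at p)" for p
    by (rule bounded_linear_imp_has_derivative[OF bl])
  then have fd: "frechet_derivative A (at p) = A" for p
    using frechet_derivative_at by metis
  have AM: "A ` M \<subseteq> N"
    using f by force
  have "A v \<in> complex_tangent_space N (f p)" if p: "p \<in> M" and v: "v \<in> complex_tangent_space M p" for p v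
  proof -
    obtain w where w: "v \<in> tangent_space M p" "w \<in> tangent_space M p" "v = \<i> *s w"
      using v unfolding complex_tangent_space_def by blast
    have "A v \<in> tangent_space N (A p)" "A w \<in> tangent_space N (A p)"
      by (rule tangent_space_image[OF d AM w(1)]) (rule tangent_space_image[OF d AM w(2)])
    then show ?thesis
      unfolding complex_tangent_space_def w(3) A(2) f(2)[OF p] by blast
  qed
  then show ?thesis
    unfolding CR_map_def
    using f A(2) smooth fd by (intro conjI ballI exI[of _ UNIV] exI[of _ A]) auto
qed

definition linear_symmetry :: "(complex^'n) set \<Rightarrow> (complex^'n \<Rightarrow> complex^'n) \<Rightarrow> (complex^'n \<Rightarrow> complex^'n) \<Rightarrow> bool"
  where "linear_symmetry M A B \<longleftrightarrow> linear A \<and> linear B \<and>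
    (\<forall>c x. A (c *s x) = c *s A x) \<and> (\<forall>c x. B (c *s x) = c *s B x) \<and>
    A ` M \<subseteq> M \<and> B ` M \<subseteq> M \<and> (\<forall>x. A (B x) = x) \<and> (\<forall>x. B (A x) = x)"

lemma linear_symmetry_inverse: "linear_symmetry M A B \<Longrightarrow> linear_symmetry M B A"
  by (simp add: linear_symmetry_def)

lemma linear_symmetry_compose:
  "linear_symmetry M A B \<Longrightarrow> linear_symmetry M A' B' \<Longrightarrow> linear_symmetry M (A \<circ> A') (B' \<circ> B)"
  unfolding linear_symmetry_def by (auto simp: linear_compose image_subset_iff)

lemma linear_symmetry_CR_diffeomorphism:
  assumes "linear_symmetry M A B"
  shows "CR_diffeomorphism M M A"
proof -
  note s = assms[unfolded linear_symmetry_def]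
  have bij: "bij_betw A M M"
    by (rule bij_betw_byWitness[where f' = B]) (use s in auto)
  have inv: "inv_into M A x = B x" if "x \<in> M" for x
    by (rule inv_into_f_eq) (use s that bij in \<open>auto simp: bij_betw_def\<close>)
  have "CR_map M M A"
    by (rule CR_map_linear[where A = A]) (use s in auto)
  moreover have "CR_map M M (inv_into M A)"
    by (rule CR_map_linear[where A = B]) (use s inv in \<open>auto simp: image_subset_iff\<close>)
  ultimately show ?thesis
    using bij by (simp add: CR_diffeomorphism_def)
qed

section \<open>The Segre map from pairs of vectors to rank one matrices\<close>

definition tens :: "complex \<times> complex \<Rightarrow> complex \<times> complex \<Rightarrow> complex^4" where
  "tens a b = (\<chi> i. (if i = 1 \<or> i = 2 then fst a else snd a) * (if i = 1 \<or> i = 3 then fst b else snd b))"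

lemma tens_nth [simp]:
  "tens a b $ 1 = fst a * fst b" "tens a b $ 2 = fst a * snd b"
  "tens a b $ 3 = snd a * fst b" "tens a b $ 4 = snd a * snd b"
  by (simp_all add: tens_def)

lemma vec4_eq_iff: "(v :: 'a^4) = w \<longleftrightarrow> v$1 = w$1 \<and> v$2 = w$2 \<and> v$3 = w$3 \<and> v$4 = w$4"
  by (auto simp: vec_eq_iff forall_4)

lemma norm_pair_power2: "(norm (a :: complex \<times> complex))\<^sup>2 = (cmod (fst a))\<^sup>2 + (cmod (snd a))\<^sup>2"
  by (simp add: norm_prod_def)

lemma norm_tens: "norm (tens a b) = norm a * norm b"
proof -
  have "(norm (tens a b))\<^sup>2 = (norm a * norm b)\<^sup>2"
    by (simp add: norm_vec4 norm_pair_power2 power_mult_distrib norm_mult algebra_simps)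
  then show ?thesis
    by (simp add: power2_eq_iff_nonneg)
qed

lemma tens_in_segre_link: "norm a = 1 \<Longrightarrow> norm b = 1 \<Longrightarrow> tens a b \<in> segre_link"
  by (simp add: segre_link_def norm_tens)

text \<open>Determinant zero makes the rows proportional, so the matrix factors as a column times a
  row.\<close>

lemma segre_link_eq_tens:
  assumes "w \<in> segre_link"
  obtains a b where "norm a = 1" "norm b = 1" "w = tens a b"
proof -
  have det: "w$1 * w$4 = w$2 * w$3" and n: "norm w = 1"
    using assms by (auto simp: segre_link_def)
  \<comment> \<open>The norms of \<open>a\<close> and \<open>b\<close> multiply to 1, so shifting
    the factor \<open>norm a\<close> from \<open>a\<close> to \<open>b\<close> makes both unit
    vectors.\<close>
  have *: thesis if "w = tens a b" for a b
  proof -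
    have ab: "norm a * norm b = 1"
      using n that norm_tens by metis
    then have nz: "norm a \<noteq> 0" by auto
    have "w = tens (inverse (norm a) *\<^sub>R a) (norm a *\<^sub>R b)"
      using nz unfolding that by (simp add: vec4_eq_iff)
    moreover have "norm (inverse (norm a) *\<^sub>R a) = 1"
      using nz by simp
    moreover have "norm (norm a *\<^sub>R b) = 1"
      using ab by simp
    ultimately show thesis
      using \<open>\<And>b a. norm a = 1 \<Longrightarrow> norm b = 1 \<Longrightarrow> w = tens a b \<Longrightarrow> thesis\<close> by blast
  qed
  consider "w$1 \<noteq> 0" | "w$1 = 0" "w$2 \<noteq> 0" | "w$1 = 0" "w$2 = 0"
    by blast
  then show thesis
  proof cases
    case 1
    then show thesis
      using det by (intro *[of "(1, w$3 / w$1)" "(w$1, w$2)"]) (simp add: vec4_eq_iff field_simps)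
  next
    case 2
    then show thesis
      using det by (intro *[of "(1, w$4 / w$2)" "(w$1, w$2)"]) (simp add: vec4_eq_iff field_simps)
  next
    case 3
    then show thesis
      by (intro *[of "(0, 1)" "(w$3, w$4)"]) (simp add: vec4_eq_iff)
  qed
qed

text \<open>The matrices \<open>w \<mapsto> P w\<close> and \<open>w \<mapsto> w Q\<close> with \<open>P, Q \<in> SU(2)\<close>, for \<open>w = ((w1, w2), (w3, w4))\<close>.\<close>

definition lact :: "complex \<times> complex \<Rightarrow> complex^4 \<Rightarrow> complex^4" where
  "lact a w = (\<chi> i. if i = 1 then fst a * w$1 - cnj (snd a) * w$3
    else if i = 2 then fst a * w$2 - cnj (snd a) * w$4
    else if i = 3 then snd a * w$1 + cnj (fst a) * w$3
    else snd a * w$2 + cnj (fst a) * w$4)"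

definition ract :: "complex \<times> complex \<Rightarrow> complex^4 \<Rightarrow> complex^4" where
  "ract b w = (\<chi> i. if i = 1 then fst b * w$1 - cnj (snd b) * w$2
    else if i = 2 then snd b * w$1 + cnj (fst b) * w$2
    else if i = 3 then fst b * w$3 - cnj (snd b) * w$4
    else snd b * w$3 + cnj (fst b) * w$4)"

lemma act_nth [simp]:
  "lact a w $ 1 = fst a * w$1 - cnj (snd a) * w$3" "lact a w $ 2 = fst a * w$2 - cnj (snd a) * w$4"
  "lact a w $ 3 = snd a * w$1 + cnj (fst a) * w$3" "lact a w $ 4 = snd a * w$2 + cnj (fst a) * w$4"
  "ract a w $ 1 = fst a * w$1 - cnj (snd a) * w$2" "ract a w $ 2 = snd a * w$1 + cnj (fst a) * w$2"
  "ract a w $ 3 = fst a * w$3 - cnj (snd a) * w$4" "ract a w $ 4 = snd a * w$3 + cnj (fst a) * w$4"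
  by (simp_all add: lact_def ract_def)

lemma linear_act: "linear (lact a)" "linear (ract a)"
  by (rule linearI; simp add: vec4_eq_iff algebra_simps)+

lemma act_scale: "lact a (c *s w) = c *s lact a w" "ract a (c *s w) = c *s ract a w"
  by (simp_all add: vec4_eq_iff algebra_simps)

lemma cmod_rotation:
  "(cmod (a * x - cnj b * y))\<^sup>2 + (cmod (b * x + cnj a * y))\<^sup>2 =
    ((cmod a)\<^sup>2 + (cmod b)\<^sup>2) * ((cmod x)\<^sup>2 + (cmod y)\<^sup>2)"
  unfolding cmod_power2 by (simp add: power2_eq_square algebra_simps)

text \<open>\<open>lact\<close> rotates the two columns of the matrix, \<open>ract\<close> its two
  rows.\<close>

lemma norm_act:
  assumes "norm a = 1"
  shows "norm (lact a w) = norm w" "norm (ract a w) = norm w"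
proof -
  have a: "(cmod (fst a))\<^sup>2 + (cmod (snd a))\<^sup>2 = 1"
    using assms norm_pair_power2[of a] by simp
  note rot = cmod_rotation[of "fst a" _ "snd a", unfolded a]
  have "(norm (lact a w))\<^sup>2 = (norm w)\<^sup>2"
    unfolding norm_vec4 act_nth
    using arg_cong2[OF rot[of "w$1" "w$3"] rot[of "w$2" "w$4"], of "(+)"] by (simp only: mult_1 add_ac)
  moreover have "(norm (ract a w))\<^sup>2 = (norm w)\<^sup>2"
    unfolding norm_vec4 act_nth
    using arg_cong2[OF rot[of "w$1" "w$2"] rot[of "w$3" "w$4"], of "(+)"] by (simp only: mult_1 add_ac)
  ultimately show "norm (lact a w) = norm w" "norm (ract a w) = norm w"
    by (simp_all add: power2_eq_iff_nonneg)
qed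

lemma fst_snd_unit:
  assumes "norm a = 1"
  shows "fst a * cnj (fst a) + snd a * cnj (snd a) = 1"
proof -
  have "(cmod (fst a))\<^sup>2 + (cmod (snd a))\<^sup>2 = 1"
    using norm_pair_power2[of a] assms by simp
  then show ?thesis
    unfolding complex_norm_square[symmetric] of_real_add[symmetric] by (simp only: of_real_1)
qed

lemma act_segre_link:
  assumes a: "norm a = 1"
  shows "lact a ` segre_link \<subseteq> segre_link" "ract a ` segre_link \<subseteq> segre_link"
proof -
  have "lact a w $ 1 * lact a w $ 4 = lact a w $ 2 * lact a w $ 3"
    "ract a w $ 1 * ract a w $ 4 = ract a w $ 2 * ract a w $ 3" if "w$1 * w$4 = w$2 * w$3" for w
    using that unfolding act_nth by algebra+
  then show "lact a ` segre_link \<subseteq> segre_link" "ract a ` segre_link \<subseteq> segre_link"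
    using norm_act[OF a] by (auto simp: segre_link_def simp del: act_nth)
qed

text \<open>The pair \<open>(cnj (fst a), - snd a)\<close> parametrises the adjoint, hence the
  inverse, of the SU(2) matrix of \<open>a\<close>.\<close>

lemma linear_symmetry_act:
  assumes a: "norm a = 1"
  shows "linear_symmetry segre_link (lact a) (lact (cnj (fst a), - snd a))"
    "linear_symmetry segre_link (ract a) (ract (cnj (fst a), - snd a))"
proof -
  let ?a = "(cnj (fst a), - snd a)"
  have "norm ?a = norm a"
    by (rule power2_eq_imp_eq) (simp_all add: norm_pair_power2)
  then have a': "norm ?a = 1"
    using a by simp
  note u = fst_snd_unit[OF a]
  have "lact a (lact ?a w) = w" "lact ?a (lact a w) = w"
    "ract a (ract ?a w) = w" "ract ?a (ract a w) = w" for w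
    unfolding vec4_eq_iff act_nth fst_conv snd_conv complex_cnj_cnj complex_cnj_minus
    by (intro conjI; use u in algebra)+
  then show "linear_symmetry segre_link (lact a) (lact ?a)"
    "linear_symmetry segre_link (ract a) (ract ?a)"
    using act_segre_link[OF a] act_segre_link[OF a']
    by (simp_all add: linear_symmetry_def linear_act act_scale)
qed

lemma CR_homogeneous_segre_link: "CR_homogeneous segre_link"
  unfolding CR_homogeneous_def
proof (intro ballI)
  let ?e = "tens (1, 0) (1, 0)"
  \<comment> \<open>\<open>?e\<close> is the matrix with single entry 1 in the corner;
    \<open>lact a\<close> and \<open>ract b\<close> carry it to \<open>tens a b\<close>, so its
    orbit is all of the link.\<close>
  have orbit: "\<exists>A B. linear_symmetry segre_link A B \<and> A ?e = p" if p: "p \<in> segre_link" for p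
  proof -
    obtain a b where ab: "norm a = 1" "norm b = 1" "p = tens a b"
      using segre_link_eq_tens[OF p] .
    have "(lact a \<circ> ract b) ?e = p"
      by (simp add: ab(3) vec4_eq_iff)
    then show ?thesis
      using linear_symmetry_compose[OF linear_symmetry_act(1)[OF ab(1)] linear_symmetry_act(2)[OF ab(2)]]
      by blast
  qed
  fix p q :: "complex^4" assume "p \<in> segre_link" "q \<in> segre_link"
  then obtain A B A' B' where s: "linear_symmetry segre_link A B" "A ?e = p"
    "linear_symmetry segre_link A' B'" "A' ?e = q"
    using orbit by meson
  have "linear_symmetry segre_link (A' \<circ> B) (A \<circ> B')"
    by (rule linear_symmetry_compose[OF s(3) linear_symmetry_inverse[OF s(1)]])
  moreover have "(A' \<circ> B) p = q"
    using s unfolding linear_symmetry_def by auto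
  ultimately show "\<exists>f. CR_diffeomorphism segre_link segre_link f \<and> f p = q"
    using linear_symmetry_CR_diffeomorphism by blast
qed

section \<open>Frame fields on the product of two 3-spheres\<close>

text \<open>A conjugate-linear map with square -1: multiplication by a quaternion unit anticommuting
  with \<open>phase_turn\<close>. It and its composite with \<open>phase_turn\<close> will span the
  complex tangent directions.\<close>

definition quarter_turn :: "complex \<times> complex \<Rightarrow> complex \<times> complex" where
  "quarter_turn a = (- cnj (snd a), cnj (fst a))"

definition phase_turn :: "complex \<times> complex \<Rightarrow> complex \<times> complex" where
  "phase_turn a = (\<i> * fst a, \<i> * snd a)"

lemma linear_turns: "linear quarter_turn" "linear phase_turn"
  by (rule linearI; simp add: quarter_turn_def phase_turn_def algebra_simps scaleR_conv_of_real)+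

lemma turn_turn [simp]:
  "quarter_turn (quarter_turn a) = - a" "phase_turn (phase_turn a) = - a"
  "quarter_turn (phase_turn a) = - phase_turn (quarter_turn a)"
  "quarter_turn (- a) = - quarter_turn a" "phase_turn (- a) = - phase_turn a"
  by (simp_all add: quarter_turn_def phase_turn_def prod_eq_iff)

lemma turn_norm_inner:
  "norm (quarter_turn a) = norm a" "norm (phase_turn a) = norm a"
  "a \<bullet> quarter_turn a = 0" "a \<bullet> phase_turn a = 0"
  by (simp_all add: quarter_turn_def phase_turn_def norm_prod_def norm_mult inner_prod_def
      inner_complex_def add.commute)

lemma turn_phase_quarter_norm_inner:
  "norm (phase_turn (quarter_turn a)) = norm a" "a \<bullet> phase_turn (quarter_turn a) = 0"
  by (simp_all add: turn_norm_inner) (simp add: quarter_turn_def phase_turn_def inner_prod_def inner_complex_def)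

text \<open>The great circle through \<open>a\<close> and \<open>u\<close>, paired with a constant,
  is the required curve.\<close>

lemma tangent_space_sphere_Times:
  assumes ab: "norm a = 1" "norm b = 1" and u: "norm u = 1" "a \<bullet> u = 0"
  shows "(u, 0) \<in> tangent_space (sphere 0 1 \<times> sphere 0 1) (a, b)"
    "(0, u) \<in> tangent_space (sphere 0 1 \<times> sphere 0 1) (b, a)"
proof -
  have "(norm (cos t *\<^sub>R a + sin t *\<^sub>R u))\<^sup>2 = 1" for t
  proof -
    have "(norm (cos t *\<^sub>R a + sin t *\<^sub>R u))\<^sup>2 =
        (cos t)\<^sup>2 * (norm a)\<^sup>2 + 2 * (cos t * sin t * (a \<bullet> u)) + (sin t)\<^sup>2 * (norm u)\<^sup>2"
      unfolding power2_norm_eq_inner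
      by (simp add: inner_add_left inner_add_right inner_commute[of u a] power2_eq_square algebra_simps)
    then show ?thesis
      using ab u by simp
  qed
  then have n: "norm (cos t *\<^sub>R a + sin t *\<^sub>R u) = 1" for t
    using power2_eq_1_iff norm_ge_zero by (smt (verit))
  have d: "((\<lambda>t. cos t *\<^sub>R a + sin t *\<^sub>R u) has_vector_derivative u) (at 0)"
    by (auto intro!: derivative_eq_intros)
  show "(u, 0) \<in> tangent_space (sphere 0 1 \<times> sphere 0 1) (a, b)"
    unfolding tangent_space_def
    by (intro CollectI exI[of _ "\<lambda>t. (cos t *\<^sub>R a + sin t *\<^sub>R u, b)"] conjI
        has_vector_derivative_Pair d has_vector_derivative_const) (simp_all add: n ab)
  show "(0, u) \<in> tangent_space (sphere 0 1 \<times> sphere 0 1) (b, a)"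
    unfolding tangent_space_def
    by (intro CollectI exI[of _ "\<lambda>t. (b, cos t *\<^sub>R a + sin t *\<^sub>R u)"] conjI
        has_vector_derivative_Pair d has_vector_derivative_const) (simp_all add: n ab)
qed

definition on_fst :: "('a \<Rightarrow> 'a) \<Rightarrow> 'a \<times> 'b \<Rightarrow> 'a \<times> 'b::zero" where
  "on_fst A p = (A (fst p), 0)"

definition on_snd :: "('b \<Rightarrow> 'b) \<Rightarrow> 'a \<times> 'b \<Rightarrow> 'a::zero \<times> 'b" where
  "on_snd A p = (0, A (snd p))"

lemma linear_on_fst: "linear A \<Longrightarrow> linear (on_fst A)"
  by (rule linearI) (simp_all add: on_fst_def linear_add linear_cmul)

lemma linear_on_snd: "linear A \<Longrightarrow> linear (on_snd A)"
  by (rule linearI) (simp_all add: on_snd_def linear_add linear_cmul)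

lemma su2_fields_turns:
  "su2_fields (on_fst quarter_turn) (on_fst (phase_turn \<circ> quarter_turn)) (on_fst phase_turn)"
  "su2_fields (on_snd quarter_turn) (on_snd (phase_turn \<circ> quarter_turn)) (on_snd phase_turn)"
  unfolding su2_fields_def
  by (auto intro!: linear_on_fst linear_on_snd linear_turns linear_compose
      simp: on_fst_def on_snd_def simp del: split_paired_All)

lemma tens_algebra:
  "tens (a + a') b = tens a b + tens a' b" "tens a (b + b') = tens a b + tens a b'"
  "tens (r *\<^sub>R a) b = r *\<^sub>R tens a b" "tens a (r *\<^sub>R b) = r *\<^sub>R tens a b"
  "tens 0 b = 0" "tens a 0 = 0"
  "tens (phase_turn a) b = \<i> *s tens a b" "tens a (phase_turn b) = \<i> *s tens a b"
  by (simp_all add: vec4_eq_iff algebra_simps phase_turn_def)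

lemma bounded_bilinear_tens: "bounded_bilinear tens"
proof -
  have "bilinear tens"
    unfolding bilinear_def by (intro conjI allI linearI) (simp_all only: tens_algebra)
  then show ?thesis
    by (simp add: bilinear_conv_bounded_bilinear)
qed

abbreviation segre :: "(complex \<times> complex) \<times> (complex \<times> complex) \<Rightarrow> complex^4" where
  "segre q \<equiv> tens (fst q) (snd q)"

lemma smooth_segre: "smooth_on UNIV segre"
  by (intro smooth_on_bilinear[OF bounded_bilinear_tens] smooth_on_linear bounded_linear_fst
      bounded_linear_snd open_UNIV)

lemma segre_has_derivative:
  "(segre has_derivative (\<lambda>v. tens (fst q) (snd v) + tens (fst v) (snd q))) (at q)"
  by (intro bounded_bilinear.FDERIV[OF bounded_bilinear_tens]
      bounded_linear_imp_has_derivative bounded_linear_fst bounded_linear_snd)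

text \<open>The extension \<open>F\<close> works near \<open>segre q\<close> only, and the Cauchy-Riemann equations of \<open>CR_map\<close> at a
  nearby point concern another extension; both have the same derivative on tangent vectors.\<close>

lemma CR_map_sphere_degenerate:
  fixes f :: "complex^4 \<Rightarrow> complex^3"
  assumes M: "openin (top_of_set segre_link) M" and f: "CR_map M W f" "W \<subseteq> sphere 0 1"
    and V: "open V" "smooth_on V F" "\<And>x. x \<in> M \<inter> V \<Longrightarrow> F x = f x"
    and ab: "norm a = 1" "norm b = 1" "tens a b \<in> M \<inter> V"
  shows "frechet_derivative F (at (tens a b)) (tens (quarter_turn a) b) = 0"
    and "tens (quarter_turn a) b \<in> tangent_space M (tens a b)"
proof -
  obtain O' where O': "open O'" "M = segre_link \<inter> O'"
    using M by (meson openin_open)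
  define U where "U = segre -` (V \<inter> O')"
  define N where "N = (sphere 0 1 \<times> sphere 0 1) \<inter> U"
  have cont: "continuous_on UNIV segre"
    using smooth_segre unfolding smooth_on_def by (metis Ck_on.simps(1))
  have U: "open U"
    unfolding U_def using continuous_open_preimage[OF cont open_UNIV open_Int[OF V(1) O'(1)]] by simp
  have NU: "N \<subseteq> U" by (simp add: N_def)
  have segre_U: "segre q \<in> V" if "q \<in> U" for q
    using that by (simp add: U_def)
  have segre_N: "segre q \<in> M \<inter> V" if "q \<in> N" for q
    using that O'(2) by (auto simp: N_def U_def tens_in_segre_link)
  define G where "G q = F (segre q)" for q
  have G: "smooth_on U G"
    unfolding G_def[abs_def]
    by (rule smooth_on_compose[OF U V(1) _ V(2) smooth_on_subset[OF smooth_segre subset_UNIV]])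
      (use segre_U in auto)
  let ?J = "quarter_turn" and ?iJ = "phase_turn \<circ> quarter_turn" and ?i = "phase_turn"
  have dG: "field_deriv A G q = frechet_derivative F (at (segre q)) (tens (fst q) (snd (A q)) + tens (fst (A q)) (snd q))"
    if "q \<in> U" for A q
  proof -
    have "(G has_derivative (\<lambda>v. frechet_derivative F (at (segre q))
        (tens (fst q) (snd v) + tens (fst v) (snd q)))) (at q)"
      unfolding G_def[abs_def]
      by (rule has_derivative_compose[OF segre_has_derivative smooth_on_has_derivative[OF V(2) segre_U[OF that]]])
    then show ?thesis
      unfolding field_deriv_def by (simp add: frechet_derivative_at[symmetric])
  qed
  have tangent: "A q \<in> tangent_space N q"
    if A: "A \<in> {on_fst ?J, on_fst ?iJ, on_fst ?i, on_snd ?J, on_snd ?iJ, on_snd ?i}" and q: "q \<in> N" for A q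
  proof -
    obtain x y where xy: "q = (x, y)" "norm x = 1" "norm y = 1" "q \<in> U"
      using q by (auto simp: N_def)
    have "A q \<in> tangent_space (sphere 0 1 \<times> sphere 0 1) q"
      using A xy(2,3)
      by (auto intro!: tangent_space_sphere_Times
          simp: xy(1) on_fst_def on_snd_def turn_norm_inner turn_phase_quarter_norm_inner)
    then show ?thesis
      unfolding N_def by (rule tangent_space_open_Int[OF U xy(4)])
  qed
  have push: "tens (fst q) (snd v) + tens (fst v) (snd q) \<in> tangent_space M (segre q)"
    if "v \<in> tangent_space N q" for v q
    by (rule tangent_space_image[OF segre_has_derivative _ that]) (use segre_N in auto)
  \<comment> \<open>The last condition says that the push-forward of \<open>Y\<close> is
    \<open>\<i>\<close> times that of \<open>X\<close>; annihilation by \<open>X + \<i> Y\<close> is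
    then the Cauchy-Riemann equation of \<open>f\<close>.\<close>
  have CR: "complex_deriv \<i> X Y G q = 0"
    if q: "q \<in> N" and X: "X q \<in> tangent_space N q" and Y: "Y q \<in> tangent_space N q"
      and XY: "tens (fst q) (snd (Y q)) + tens (fst (Y q)) (snd q)
        = \<i> *s (tens (fst q) (snd (X q)) + tens (fst (X q)) (snd q))"
    for X Y q
  proof -
    let ?v = "tens (fst q) (snd (X q)) + tens (fst (X q)) (snd q)"
    have v: "?v \<in> tangent_space M (segre q)" and iv: "\<i> *s ?v \<in> tangent_space M (segre q)"
      using push[OF X] push[OF Y] XY by simp_all
    have "\<i> *s (- (\<i> *s ?v)) = ?v"
      by (simp add: vec4_eq_iff)
    then have v': "?v \<in> complex_tangent_space M (segre q)"
      unfolding complex_tangent_space_def using v tangent_space_uminus[OF iv]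
      by (metis IntI image_eqI)
    obtain V' F' where F': "open V'" "segre q \<in> V'" "smooth_on V' F'" "\<And>x. x \<in> M \<inter> V' \<Longrightarrow> F' x = f x"
      "frechet_derivative F' (at (segre q)) (\<i> *s ?v) = \<i> *s frechet_derivative F' (at (segre q)) ?v"
      using f(1) segre_N[OF q] v' unfolding CR_map_def by (metis Int_iff)
    have same: "frechet_derivative F (at (segre q)) w = frechet_derivative F' (at (segre q)) w"
      if "w \<in> tangent_space M (segre q)" for w
      by (rule tangent_space_has_derivative_eq[OF smooth_on_has_derivative[OF V(2)]
          smooth_on_has_derivative[OF F'(3,2)] open_Int[OF V(1) F'(1)] _ _ that])
        (use F'(2,4) V(3) segre_N[OF q] in auto)
    have "complex_deriv \<i> X Y G q = frechet_derivative F' (at (segre q)) ?v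
        + \<i> *s frechet_derivative F' (at (segre q)) (\<i> *s ?v)"
      using q NU unfolding complex_deriv_def by (auto simp: dG XY same[OF v] same[OF iv] simp del: vector_add_ldistrib)
    also have "\<dots> = 0"
      unfolding F'(5) by (simp add: vec_eq_iff)
    finally show ?thesis .
  qed
  interpret lifted_sphere_map U N "on_fst ?J" "on_fst ?iJ" "on_fst ?i" "on_snd ?J" "on_snd ?iJ" "on_snd ?i" G
  proof
    show "A (B p) = B (A p)" if "A \<in> {on_fst ?J, on_fst ?iJ, on_fst ?i}"
      "B \<in> {on_snd ?J, on_snd ?iJ, on_snd ?i}" for A B p
      using that by (auto simp: on_fst_def on_snd_def quarter_turn_def phase_turn_def zero_prod_def)
    show "hdot (G q) (G q) = 1" if "q \<in> N" for q
    proof -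
      have "f (segre q) \<in> sphere 0 1"
        using f segre_N[OF that] unfolding CR_map_def by blast
      then show ?thesis
        using V(3)[OF segre_N[OF that]] by (simp add: G_def hdot_self)
    qed
    show "complex_deriv \<i> (on_fst ?J) (on_fst ?iJ) G q = 0" if "q \<in> N" for q
    proof (rule CR[OF that])
      show "on_fst ?J q \<in> tangent_space N q" "on_fst ?iJ q \<in> tangent_space N q"
        by (rule tangent[OF _ that]; blast)+
    qed (simp add: on_fst_def tens_algebra)
    show "complex_deriv \<i> (on_snd ?J) (on_snd ?iJ) G q = 0" if "q \<in> N" for q
    proof (rule CR[OF that])
      show "on_snd ?J q \<in> tangent_space N q" "on_snd ?iJ q \<in> tangent_space N q"
        by (rule tangent[OF _ that]; blast)+
    qed (simp add: on_snd_def tens_algebra)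
    \<comment> \<open>Both fields push forward to \<open>\<i> *s segre q\<close>, as a scalar moves
      freely between the slots of \<open>tens\<close>.\<close>
    show "field_deriv (on_fst ?i) G q = field_deriv (on_snd ?i) G q" if "q \<in> U" for q
      by (simp add: dG[OF that] on_fst_def on_snd_def tens_algebra)
  qed (use U NU G su2_fields_turns tangent in auto)
  have ab': "(a, b) \<in> N"
    using ab O'(2) by (auto simp: N_def U_def)
  then show "frechet_derivative F (at (tens a b)) (tens (quarter_turn a) b) = 0"
    using X1_F_eq_0[OF ab'] dG[of "(a, b)" "on_fst ?J"] NU by (auto simp: on_fst_def tens_algebra)
  show "tens (quarter_turn a) b \<in> tangent_space M (tens a b)"
    using push[OF tangent[of "on_fst ?J", OF _ ab']] by (simp add: on_fst_def tens_algebra)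
qed

text \<open>The inverse of a spherical chart has a smooth extension \<open>G\<close> near
  \<open>f ?p\<close>, and \<open>G\<close> undoes \<open>F\<close> on \<open>M\<close> near
  \<open>?p\<close>. So the derivative of \<open>F\<close> is injective on tangent vectors, against
  \<open>CR_map_sphere_degenerate\<close>.\<close>

lemma not_CR_spherical_segre_link: "\<not> CR_spherical TYPE(3) segre_link"
proof
  assume sph: "CR_spherical TYPE(3) segre_link"
  let ?e = "(1, 0) :: complex \<times> complex"
  let ?p = "tens ?e ?e"
  have e: "norm ?e = 1"
    by (simp add: norm_prod_def)
  have "?p \<in> segre_link"
    by (rule tens_in_segre_link[OF e e])
  then obtain M W and f :: "complex^4 \<Rightarrow> complex^3" where
    M: "openin (top_of_set segre_link) M" "?p \<in> M" and
    W: "openin (top_of_set (sphere (0 :: complex^3) 1)) W" and f: "CR_diffeomorphism M W f"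
    using sph unfolding CR_spherical_def by meson
  have bij: "bij_betw f M W" and CR: "CR_map M W f" "CR_map W M (inv_into M f)"
    using f unfolding CR_diffeomorphism_def by auto
  have fp: "f ?p \<in> W"
    using bij M(2) bij_betwE by blast
  obtain V F where V: "open V" "?p \<in> V" "smooth_on V F" "\<And>x. x \<in> M \<inter> V \<Longrightarrow> F x = f x"
    using CR(1) M(2) unfolding CR_map_def by metis
  obtain V' G where V': "open V'" "f ?p \<in> V'" "smooth_on V' G" "\<And>x. x \<in> W \<inter> V' \<Longrightarrow> G x = inv_into M f x"
    using CR(2) fp unfolding CR_map_def by metis
  \<comment> \<open>This is the third coordinate vector, since
    \<open>quarter_turn ?e = (0, 1)\<close>.\<close>
  let ?v = "tens (quarter_turn ?e) ?e"
  have W1: "W \<subseteq> sphere 0 1"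
    using W openin_imp_subset by blast
  have deg: "frechet_derivative F (at ?p) ?v = 0" and v: "?v \<in> tangent_space M ?p"
    using CR_map_sphere_degenerate[OF M(1) CR(1) W1 V(1,3,4) e e] M(2) V(2) by auto
  have Fp: "F ?p = f ?p"
    using V(2,4) M(2) by auto
  have "continuous_on V F"
    using V(3) unfolding smooth_on_def by (metis Ck_on.simps(1))
  then have op: "open (V \<inter> F -` V')"
    by (rule continuous_open_preimage[OF _ V(1) V'(1)])
  have "((\<lambda>x. G (F x)) has_derivative (\<lambda>v. frechet_derivative G (at (F ?p)) (frechet_derivative F (at ?p) v))) (at ?p)"
    by (rule has_derivative_compose[OF smooth_on_has_derivative[OF V(3,2)]])
      (use smooth_on_has_derivative[OF V'(3,2)] Fp in simp)
  then have "frechet_derivative G (at (F ?p)) (frechet_derivative F (at ?p) ?v) = ?v"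
  proof (rule tangent_space_has_derivative_eq[OF _ has_derivative_ident op _ _ v])
    show "G (F x) = x" if "x \<in> M \<inter> (V \<inter> F -` V')" for x
      using that V(4)[of x] V'(4)[of "f x"] bij by (auto simp: bij_betw_def)
  qed (use V(2) V'(2) Fp in simp)
  moreover have "frechet_derivative G (at (F ?p)) 0 = 0"
    by (rule linear_0[OF has_derivative_linear]) (use smooth_on_has_derivative[OF V'(3,2)] Fp in simp)
  ultimately have "?v = 0"
    using deg by simp
  then have "?v $ 3 = 0"
    by simp
  then show False
    by (simp add: quarter_turn_def)
qed

text \<open>The frontier is taken relative to \<open>V\<close>: in the whole space \<open>G\<close>
  has empty interior, and its frontier would be its closure. The index 3 fits the real dimension 5
  of \<open>M\<close>.\<close>

theorem proposition6p1:
  fixes V G M :: "(complex^4) set"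
  defines "V \<equiv> {w. w$1 * w$4 = w$2 * w$3}"
    and "G \<equiv> {w. (cmod (w$1))\<^sup>2 + (cmod (w$2))\<^sup>2 + (cmod (w$3))\<^sup>2 + (cmod (w$4))\<^sup>2 < 1 \<and>
                 w$1 * w$4 = w$2 * w$3}"
    and "M \<equiv> (top_of_set V) frontier_of G"
  shows "CR_homogeneous M \<and> \<not> CR_spherical TYPE(3) M"
proof -
  have "G = {w. norm w < 1 \<and> w$1 * w$4 = w$2 * w$3}"
    unfolding G_def norm_vec4[symmetric] by (simp add: power_less_one_iff)
  then have "M = segre_link"
    unfolding M_def by (rule frontier_eq_segre_link[OF V_def[THEN meta_eq_to_obj_eq]])
  then show ?thesis
    using CR_homogeneous_segre_link not_CR_spherical_segre_link by simp
qed

end
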